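(* Let $p$ be an odd prime and $R_p$ the dihedral quandle. For every $n$, every torsion element of the integral rack homology group $H^R_n(R_p)$ and of the integral rack cohomology group $H_R^n(R_p)$ is annihilated by $p$. The same is true of the integral quandle homology groups $H^Q_n(R_p)$ and quandle cohomology groups $H_Q^n(R_p)$.
   Context: $R_p$ is the set $\mathbf Z/p$ with operation $a*b=2b-a$. For a rack $X$, $C^R_n(X)$ is the free abelian group on $X^n$, with boundary $\partial=\sum_{i=1}^n(-1)^i(\partial^0_i-\partial^1_i)$, where $\partial^0_i(x_1,\dots,x_n)=(x_1,\dots,x_{i-1},x_{i+1},\dots,x_n)$ and $\partial^1_i(x_1,\dots,x_n)=(x_1*x_i,\dots,x_{i-1}*x_i,x_{i+1},\dots,x_n)$. Its homology and cohomology (with $\mathbf Z$-coefficients) are the rack homology $H^R_n(X)$ and rack cohomology $H_R^n(X)$. For a quandle $X$, the subgroups $C^D_n(X)\subseteq C^R_n(X)$ generated by tuples with $x_i=x_{i+1}$ for some $i$ form a subcomplex; the homology and cohomology of the quotient complex $C^Q_n(X)=C^R_n(X)/C^D_n(X)$ are the quandle homology $H^Q_n(X)$ and quandle cohomology $H_Q^n(X)$. *)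

theory Defs
  imports "HOL-Algebra.Free_Abelian_Groups" "HOL-Number_Theory.Cong"
begin

section \<open>Racks, quandles and the dihedral quandle\<close>

locale rack =
  fixes X :: "'a set" and op :: "'a \<Rightarrow> 'a \<Rightarrow> 'a"
  assumes closed: "\<lbrakk>a \<in> X; b \<in> X\<rbrakk> \<Longrightarrow> op a b \<in> X"
    and right_bij: "b \<in> X \<Longrightarrow> bij_betw (\<lambda>a. op a b) X X"
    and right_distrib: "\<lbrakk>a \<in> X; b \<in> X; c \<in> X\<rbrakk> \<Longrightarrow> op (op a b) c = op (op a c) (op b c)"

locale quandle = rack +
  assumes idem: "a \<in> X \<Longrightarrow> op a a = a"

definition dihedral_set :: "nat \<Rightarrow> int set" where
  "dihedral_set p = {0..<int p}"

definition dihedral_op :: "nat \<Rightarrow> int \<Rightarrow> int \<Rightarrow> int" where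
  "dihedral_op p a b = (2 * b - a) mod int p"

lemma quandle_dihedral:
  assumes "p > 0"
  shows "quandle (dihedral_set p) (dihedral_op p)"
proof
  fix a b c :: int
  show "dihedral_op p a b \<in> dihedral_set p"
    using assms by (simp add: dihedral_op_def dihedral_set_def)
  have "[2 * ((2 * c - b) mod int p) - (2 * c - a) mod int p
      = 2 * c - (2 * b - a) mod int p] (mod int p)"
  proof -
    have "[2 * ((2 * c - b) mod int p) - (2 * c - a) mod int p
        = 2 * (2 * c - b) - (2 * c - a)] (mod int p)"
      by (intro cong_diff cong_mult cong_refl cong_mod_leftI)
    also have "2 * (2 * c - b) - (2 * c - a) = 2 * c - (2 * b - a)"
      by simp
    also have "[\<dots> = 2 * c - (2 * b - a) mod int p] (mod int p)"
      by (intro cong_diff cong_refl cong_mod_rightI)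
    finally show ?thesis .
  qed
  then show "dihedral_op p (dihedral_op p a b) c
      = dihedral_op p (dihedral_op p a c) (dihedral_op p b c)"
    by (simp add: dihedral_op_def cong_def)
  show "dihedral_op p a a = a" if "a \<in> dihedral_set p"
    using that by (simp add: dihedral_op_def dihedral_set_def)
  show "bij_betw (\<lambda>a. dihedral_op p a b) (dihedral_set p) (dihedral_set p)"
    by (rule bij_betw_byWitness[where f' = "\<lambda>a. dihedral_op p a b"])
      (use assms in \<open>auto simp: dihedral_op_def dihedral_set_def mod_simps\<close>)
qed


section \<open>Homology and integral cohomology of a complex of abelian groups\<close>

text \<open>
  A complex is given by groups \<open>C n\<close> and boundaries \<open>d n\<close> from \<open>C n\<close> to \<open>C (n - 1)\<close>, for
  all integers \<open>n\<close>. Groups are written multiplicatively, as in the library, so that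
  \<open>\<one>\<close> is the zero element and \<open>x [^] m\<close> is the multiple \<open>m x\<close>.
\<close>

definition complex_homology ::
    "(int \<Rightarrow> 'c monoid) \<Rightarrow> (int \<Rightarrow> 'c \<Rightarrow> 'c) \<Rightarrow> int \<Rightarrow> 'c set monoid" where
  "complex_homology C d n =
     subgroup_generated (C n) (kernel (C n) (C (n - 1)) (d n)) Mod (d (n + 1) ` carrier (C (n + 1)))"

text \<open>
  The group of homomorphisms to the integers; restricting to the carrier makes equality
  of cochains coincide with equality on the carrier.
\<close>

definition dual_group :: "'c monoid \<Rightarrow> ('c \<Rightarrow> int) monoid" where
  "dual_group G =
     \<lparr>carrier = hom G integer_group \<inter> extensional (carrier G),
      monoid.mult = (\<lambda>f g. \<lambda>x\<in>carrier G. f x + g x),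
      one = (\<lambda>x\<in>carrier G. 0)\<rparr>"

definition coboundary ::
    "(int \<Rightarrow> 'c monoid) \<Rightarrow> (int \<Rightarrow> 'c \<Rightarrow> 'c) \<Rightarrow> int \<Rightarrow> ('c \<Rightarrow> int) \<Rightarrow> ('c \<Rightarrow> int)" where
  "coboundary C d n f = (\<lambda>x\<in>carrier (C (n + 1)). f (d (n + 1) x))"

definition complex_cohomology ::
    "(int \<Rightarrow> 'c monoid) \<Rightarrow> (int \<Rightarrow> 'c \<Rightarrow> 'c) \<Rightarrow> int \<Rightarrow> ('c \<Rightarrow> int) set monoid" where
  "complex_cohomology C d n =
     subgroup_generated (dual_group (C n))
       (kernel (dual_group (C n)) (dual_group (C (n + 1))) (coboundary C d n))
     Mod (coboundary C d (n - 1) ` carrier (dual_group (C (n - 1))))"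

definition torsion_elements :: "'c monoid \<Rightarrow> 'c set" where
  "torsion_elements G = {x \<in> carrier G. \<exists>m::nat. m > 0 \<and> x [^]\<^bsub>G\<^esub> m = \<one>\<^bsub>G\<^esub>}"

definition torsion_annihilated_by :: "nat \<Rightarrow> 'c monoid \<Rightarrow> bool" where
  "torsion_annihilated_by m G \<longleftrightarrow> (\<forall>x \<in> torsion_elements G. x [^]\<^bsub>G\<^esub> m = \<one>\<^bsub>G\<^esub>)"


section \<open>The rack and quandle complexes\<close>

definition rack_tuples :: "'a set \<Rightarrow> int \<Rightarrow> 'a list set" where
  "rack_tuples X n = {xs. int (length xs) = n \<and> set xs \<subseteq> X}"

text \<open>The trivial group for \<open>n < 0\<close>, and the integers (on the empty tuple) for \<open>n = 0\<close>.\<close>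

definition rack_chain_group :: "'a set \<Rightarrow> int \<Rightarrow> ('a list \<Rightarrow>\<^sub>0 int) monoid" where
  "rack_chain_group X n = free_Abelian_group (rack_tuples X n)"

text \<open>The faces are indexed from 1, whereas \<open>xs ! i\<close> counts from 0.\<close>

definition rack_face0 :: "nat \<Rightarrow> 'a list \<Rightarrow> 'a list" where
  "rack_face0 i xs = take (i - 1) xs @ drop i xs"

definition rack_face1 :: "('a \<Rightarrow> 'a \<Rightarrow> 'a) \<Rightarrow> nat \<Rightarrow> 'a list \<Rightarrow> 'a list" where
  "rack_face1 op i xs = map (\<lambda>x. op x (xs ! (i - 1))) (take (i - 1) xs) @ drop i xs"

definition rack_boundary ::
    "('a \<Rightarrow> 'a \<Rightarrow> 'a) \<Rightarrow> int \<Rightarrow> ('a list \<Rightarrow>\<^sub>0 int) \<Rightarrow> ('a list \<Rightarrow>\<^sub>0 int)" where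
  "rack_boundary op n =
     frag_extend (\<lambda>xs. \<Sum>i = 1..nat n.
       frag_cmul ((-1) ^ i) (frag_of (rack_face0 i xs) - frag_of (rack_face1 op i xs)))"

definition degenerate_chains :: "'a set \<Rightarrow> int \<Rightarrow> ('a list \<Rightarrow>\<^sub>0 int) set" where
  "degenerate_chains X n =
     generate (rack_chain_group X n)
       (frag_of ` {xs \<in> rack_tuples X n. \<exists>i. Suc i < length xs \<and> xs ! i = xs ! Suc i})"

definition quandle_chain_group :: "'a set \<Rightarrow> int \<Rightarrow> ('a list \<Rightarrow>\<^sub>0 int) set monoid" where
  "quandle_chain_group X n = rack_chain_group X n Mod degenerate_chains X n"

text \<open>
  The induced map on cosets: for a quandle and a coset \<open>A\<close> in degree \<open>n\<close>, the boundaries of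
  all representatives of \<open>A\<close> lie in one coset, which is the only element of the image below.
\<close>

definition quandle_boundary ::
    "'a set \<Rightarrow> ('a \<Rightarrow> 'a \<Rightarrow> 'a) \<Rightarrow> int \<Rightarrow> ('a list \<Rightarrow>\<^sub>0 int) set \<Rightarrow> ('a list \<Rightarrow>\<^sub>0 int) set" where
  "quandle_boundary X op n A =
     the_elem ((\<lambda>c. degenerate_chains X (n - 1) #>\<^bsub>rack_chain_group X (n - 1)\<^esub> rack_boundary op n c) ` A)"

definition rack_homology where
  "rack_homology X op = complex_homology (rack_chain_group X) (rack_boundary op)"

definition rack_cohomology where
  "rack_cohomology X op = complex_cohomology (rack_chain_group X) (rack_boundary op)"

definition quandle_homology where
  "quandle_homology X op = complex_homology (quandle_chain_group X) (quandle_boundary X op)"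

definition quandle_cohomology where
  "quandle_cohomology X op = complex_cohomology (quandle_chain_group X) (quandle_boundary X op)"

end

theory Submission
  imports Defs
begin

text \<open>
  In a dihedral quandle of odd order the equation \<open>a * b = y\<close> has, for given \<open>a\<close> and \<open>y\<close>,
  exactly one solution \<open>b\<close>, because \<open>2\<close> is invertible. In every finite quandle \<open>X\<close> with this
  property the order of \<open>X\<close> annihilates all torsion; this is the theorem of Przytycki and Yang on
  quasigroup quandles. The reason is a chain homotopy between multiplication by \<open>card X\<close> and the
  map that sends each \<open>n\<close>-tuple to the same chain \<open>diag n\<close>, the sum of all constant tuples
  \<open>(z, ..., z)\<close>. On chains of degree \<open>n\<close> this map is the augmentation followed by forming
  multiples of the cycle \<open>diag n\<close>; it factors through the integers and therefore contributes nothing to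
  torsion classes, in homology as in cohomology (\<open>collapsing_complex.torsion_homology\<close>,
  \<open>collapsing_complex.torsion_cohomology\<close>).

  The homotopy is found by replacing the entries of a tuple one after the other. All rack chains
  arise from the empty tuple by appending entries, and up to a sign the boundary is determined by
  the rule \<open>bdry_snoc\<close> for appending an entry. The whole homotopy then follows by recursion from
  a single step, \<open>bdry_diag_link\<close>: the chains \<open>\<Sum>z. (z, ..., z, y)\<close> and \<open>\<Sum>z. (z, ..., z, z)\<close>
  differ by a boundary. Here the quasigroup property enters twice. Writing \<open>y = z * w\<close> deforms each
  \<open>(z, ..., z, y)\<close> into \<open>(y, ..., y, y)\<close>, which then occurs \<open>card X\<close> times; and since \<open>y * z\<close> runs
  through \<open>X\<close> with \<open>z\<close>, these copies can be spread over all of \<open>X\<close> again.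

  The homotopy does not respect degenerate chains. It still yields the result for quandle homology,
  because the quandle complex is a retract of the rack complex: following Litherland and Nelson, the
  assignment of \<open>x\<^sub>1 \<otimes> (x\<^sub>2 - x\<^sub>1) \<otimes> ... \<otimes> (x\<^sub>n - x\<^sub>m)\<close> to \<open>(x\<^sub>1, ..., x\<^sub>n)\<close>, where
  \<open>m = n - 1\<close>, is a chain map whose kernel consists of the degenerate chains and which is the
  identity modulo these (\<open>bdry_splitting\<close>, \<open>degenerate_chains_eq\<close>, \<open>diff_splitting_degenerate\<close>).
  The homotopy is carried over by \<open>collapsing_complex.retract\<close>.
\<close>

section \<open>Torsion in complexes with a collapsing homotopy\<close>

text \<open>
  A coset is annihilated by \<open>m\<close> exactly if the \<open>m\<close>-th power of a representative lies in \<open>B\<close>.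
\<close>

lemma torsion_annihilated_subquotient:
  assumes "comm_group G" and Z: "subgroup Z G" and B: "subgroup B G" and "B \<subseteq> Z"
    and tors: "\<And>x (m::nat). \<lbrakk>x \<in> Z; m > 0; x [^]\<^bsub>G\<^esub> m \<in> B\<rbrakk> \<Longrightarrow> x [^]\<^bsub>G\<^esub> N \<in> B"
  shows "torsion_annihilated_by N (subgroup_generated G Z Mod B)"
proof -
  interpret G: comm_group G by fact
  let ?S = "subgroup_generated G Z"
  interpret S: comm_group ?S
    by (rule G.abelian_subgroup_generated) fact
  have S: "carrier ?S = Z"
    using Z by (rule subgroup.carrier_subgroup_generated_subgroup)
  have BS: "subgroup B ?S"
    using B \<open>B \<subseteq> Z\<close> by (simp add: G.subgroup_subgroup_generated_iff S)
  interpret B: normal B ?S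
    using BS by (simp add: S.normal_iff_subgroup)
  have coset_pow: "(B #>\<^bsub>?S\<^esub> x) [^]\<^bsub>?S Mod B\<^esub> k = B \<longleftrightarrow> x [^]\<^bsub>G\<^esub> k \<in> B" if "x \<in> Z" for x and k :: nat
  proof -
    have "x [^]\<^bsub>G\<^esub> k \<in> carrier ?S"
      using S.nat_pow_closed[of x k] that by (simp add: S pow_subgroup_generated)
    then have "B #>\<^bsub>?S\<^esub> (x [^]\<^bsub>G\<^esub> k) = B \<longleftrightarrow> x [^]\<^bsub>G\<^esub> k \<in> B"
      by (metis S.coset_join1 S.coset_join2 BS)
    then show ?thesis
      using B.FactGroup_pow[of x k] that by (simp add: S pow_subgroup_generated)
  qed
  show ?thesis
    unfolding torsion_annihilated_by_def torsion_elements_def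
  proof clarsimp
    fix A and m :: nat
    assume "A \<in> carrier (?S Mod B)" and m: "m > 0" and "A [^]\<^bsub>?S Mod B\<^esub> m = B"
    then obtain x where "x \<in> Z" "A = B #>\<^bsub>?S\<^esub> x" "x [^]\<^bsub>G\<^esub> m \<in> B"
      by (auto simp: carrier_FactGroup S coset_pow)
    then show "A [^]\<^bsub>?S Mod B\<^esub> N = B"
      using tors[OF _ m] by (simp add: coset_pow)
  qed
qed

locale chain_complex =
  fixes C :: "int \<Rightarrow> 'c monoid" and d :: "int \<Rightarrow> 'c \<Rightarrow> 'c"
  assumes comm_group_C: "comm_group (C n)"
    and d_hom: "d n \<in> hom (C n) (C (n - 1))"
    and d_d: "x \<in> carrier (C (n + 1)) \<Longrightarrow> d n (d (n + 1) x) = \<one>\<^bsub>C (n - 1)\<^esub>"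
begin

lemma group_C: "group (C n)"
  using comm_group_C by (rule comm_group.axioms)

lemma d_closed: "x \<in> carrier (C n) \<Longrightarrow> d n x \<in> carrier (C (n - 1))"
  using d_hom by (rule hom_in_carrier)

lemma torsion_homologyI:
  assumes "\<And>x (m::nat). \<lbrakk>x \<in> carrier (C n); d n x = \<one>\<^bsub>C (n - 1)\<^esub>; m > 0;
      x [^]\<^bsub>C n\<^esub> m \<in> d (n + 1) ` carrier (C (n + 1))\<rbrakk>
    \<Longrightarrow> x [^]\<^bsub>C n\<^esub> N \<in> d (n + 1) ` carrier (C (n + 1))"
  shows "torsion_annihilated_by N (complex_homology C d n)"
  unfolding complex_homology_def
proof (rule torsion_annihilated_subquotient[OF comm_group_C])
  have d': "d (n + 1) \<in> hom (C (n + 1)) (C n)"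
    using d_hom[of "n + 1"] by simp
  show "subgroup (kernel (C n) (C (n - 1)) (d n)) (C n)"
    by (intro group_hom.subgroup_kernel group_hom.intro group_hom_axioms.intro group_C d_hom)
  show "subgroup (d (n + 1) ` carrier (C (n + 1))) (C n)"
    by (intro group_hom.img_is_subgroup group_hom.intro group_hom_axioms.intro group_C d')
  show "d (n + 1) ` carrier (C (n + 1)) \<subseteq> kernel (C n) (C (n - 1)) (d n)"
    using d_closed[of _ "n + 1"] by (auto simp: kernel_def d_d)
next
  fix x and m :: nat
  assume x: "x \<in> kernel (C n) (C (n - 1)) (d n)" and m: "m > 0"
    and xm: "x [^]\<^bsub>C n\<^esub> m \<in> d (n + 1) ` carrier (C (n + 1))"
  have "x \<in> carrier (C n)" "d n x = \<one>\<^bsub>C (n - 1)\<^esub>"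
    using x by (simp_all add: kernel_def)
  then show "x [^]\<^bsub>C n\<^esub> N \<in> d (n + 1) ` carrier (C (n + 1))"
    using m xm by (rule assms)
qed

end

lemma dual_group_simps [simp]:
  "carrier (dual_group G) = hom G integer_group \<inter> extensional (carrier G)"
  "f \<otimes>\<^bsub>dual_group G\<^esub> g = (\<lambda>x\<in>carrier G. f x + g x)"
  "\<one>\<^bsub>dual_group G\<^esub> = (\<lambda>x\<in>carrier G. 0)"
  by (simp_all add: dual_group_def)

lemma comm_group_dual_group:
  assumes "group G"
  shows "comm_group (dual_group G)"
proof (rule comm_groupI)
  interpret G: group G by fact
  fix f assume f: "f \<in> carrier (dual_group G)"
  show "\<exists>g\<in>carrier (dual_group G). g \<otimes>\<^bsub>dual_group G\<^esub> f = \<one>\<^bsub>dual_group G\<^esub>"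
    using f by (intro bexI[of _ "\<lambda>x\<in>carrier G. - f x"]) (auto simp: hom_def fun_eq_iff)
qed (use assms in \<open>auto simp: hom_def fun_eq_iff extensional_def group.is_monoid monoid.m_closed\<close>)

lemma dual_group_pow:
  assumes "f \<in> carrier (dual_group G)"
  shows "f [^]\<^bsub>dual_group G\<^esub> (m::nat) = (\<lambda>x\<in>carrier G. int m * f x)"
  by (induction m) (auto simp: fun_eq_iff algebra_simps)

context chain_complex
begin

lemma coboundary_hom: "coboundary C d n \<in> hom (dual_group (C n)) (dual_group (C (n + 1)))"
proof (rule homI)
  have d': "d (n + 1) \<in> hom (C (n + 1)) (C n)"
    using d_hom[of "n + 1"] by simp
  fix f assume f: "f \<in> carrier (dual_group (C n))"
  have "(\<lambda>x. f (d (n + 1) x)) \<in> hom (C (n + 1)) integer_group"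
    using hom_compose[OF d', of f integer_group] f by (simp add: comp_def)
  then show "coboundary C d n f \<in> carrier (dual_group (C (n + 1)))"
    using group.is_monoid[OF group_C[of "n + 1"]]
    by (auto simp: coboundary_def hom_def monoid.m_closed)
next
  fix f g assume "f \<in> carrier (dual_group (C n))" "g \<in> carrier (dual_group (C n))"
  show "coboundary C d n (f \<otimes>\<^bsub>dual_group (C n)\<^esub> g) =
      coboundary C d n f \<otimes>\<^bsub>dual_group (C (n + 1))\<^esub> coboundary C d n g"
    using d_closed[of _ "n + 1"] by (auto simp: coboundary_def fun_eq_iff)
qed

text \<open>
  Restriction to the carrier turns every homomorphism into a cochain, so that cocycles and
  coboundaries can be treated as plain homomorphisms, regardless of their values elsewhere.
\<close>

lemma torsion_cohomologyI:
  assumes "\<And>f m. \<lbrakk>f \<in> hom (C n) integer_group; \<And>x. x \<in> carrier (C (n + 1)) \<Longrightarrow> f (d (n + 1) x) = 0;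
      m > 0; \<exists>g \<in> hom (C (n - 1)) integer_group. \<forall>x \<in> carrier (C n). int m * f x = g (d n x)\<rbrakk>
    \<Longrightarrow> \<exists>g \<in> hom (C (n - 1)) integer_group. \<forall>x \<in> carrier (C n). int N * f x = g (d n x)"
  shows "torsion_annihilated_by N (complex_cohomology C d n)"
  unfolding complex_cohomology_def
proof (rule torsion_annihilated_subquotient)
  let ?D = "\<lambda>n. dual_group (C n)"
  have grp: "group (?D k)" for k
    using comm_group_dual_group[OF group_C] by (rule comm_group.axioms)
  have hom': "coboundary C d (n - 1) \<in> hom (?D (n - 1)) (?D n)"
    using coboundary_hom[of "n - 1"] by simp
  show "comm_group (?D n)"
    by (rule comm_group_dual_group) (rule group_C)
  show "subgroup (kernel (?D n) (?D (n + 1)) (coboundary C d n)) (?D n)"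
    by (intro group_hom.subgroup_kernel group_hom.intro group_hom_axioms.intro grp coboundary_hom)
  show "subgroup (coboundary C d (n - 1) ` carrier (?D (n - 1))) (?D n)"
    by (intro group_hom.img_is_subgroup group_hom.intro group_hom_axioms.intro grp hom')
  show "coboundary C d (n - 1) ` carrier (?D (n - 1))
      \<subseteq> kernel (?D n) (?D (n + 1)) (coboundary C d n)"
  proof
    fix f assume "f \<in> coboundary C d (n - 1) ` carrier (?D (n - 1))"
    then obtain g where g: "g \<in> carrier (?D (n - 1))" and f: "f = coboundary C d (n - 1) g"
      by auto
    have "g \<one>\<^bsub>C (n - 1)\<^esub> = 0"
      using g hom_one[of g "C (n - 1)" integer_group] by (simp add: group_C)
    then have "coboundary C d n f = \<one>\<^bsub>?D (n + 1)\<^esub>"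
      using d_closed[of _ "n + 1"] d_d[of _ n] by (auto simp: f coboundary_def fun_eq_iff)
    moreover have "f \<in> carrier (?D n)"
      unfolding f using hom' g by (rule hom_in_carrier)
    ultimately show "f \<in> kernel (?D n) (?D (n + 1)) (coboundary C d n)"
      by (simp add: kernel_def)
  qed
next
  let ?D = "\<lambda>n. dual_group (C n)"
  fix f and m :: nat
  assume f: "f \<in> kernel (?D n) (?D (n + 1)) (coboundary C d n)" and "m > 0"
    and pow: "f [^]\<^bsub>?D n\<^esub> m \<in> coboundary C d (n - 1) ` carrier (?D (n - 1))"
  have fD: "f \<in> carrier (?D n)"
    using f by (simp add: kernel_def)
  have cobd_iff: "f [^]\<^bsub>?D n\<^esub> k \<in> coboundary C d (n - 1) ` carrier (?D (n - 1)) \<longleftrightarrow>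
      (\<exists>g \<in> hom (C (n - 1)) integer_group. \<forall>x \<in> carrier (C n). int k * f x = g (d n x))" for k :: nat
  proof
    assume "\<exists>g \<in> hom (C (n - 1)) integer_group. \<forall>x \<in> carrier (C n). int k * f x = g (d n x)"
    then obtain g where g: "g \<in> hom (C (n - 1)) integer_group"
      and fg: "\<And>x. x \<in> carrier (C n) \<Longrightarrow> int k * f x = g (d n x)"
      by auto
    have "restrict g (carrier (C (n - 1))) \<in> carrier (?D (n - 1))"
      using g group.is_monoid[OF group_C] by (auto simp: hom_def monoid.m_closed)
    moreover have "f [^]\<^bsub>?D n\<^esub> k = coboundary C d (n - 1) (restrict g (carrier (C (n - 1))))"
      using fD fg d_closed by (auto simp: dual_group_pow coboundary_def fun_eq_iff)
    ultimately show "f [^]\<^bsub>?D n\<^esub> k \<in> coboundary C d (n - 1) ` carrier (?D (n - 1))"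
      by blast
  next
    assume "f [^]\<^bsub>?D n\<^esub> k \<in> coboundary C d (n - 1) ` carrier (?D (n - 1))"
    then obtain g where "g \<in> hom (C (n - 1)) integer_group"
      and "(\<lambda>x\<in>carrier (C n). int k * f x) = coboundary C d (n - 1) g"
      using fD by (auto simp: dual_group_pow)
    then show "\<exists>g \<in> hom (C (n - 1)) integer_group. \<forall>x \<in> carrier (C n). int k * f x = g (d n x)"
      by (intro bexI[of _ g]) (simp_all add: coboundary_def fun_eq_iff, meson)
  qed
  have "f (d (n + 1) x) = 0" if "x \<in> carrier (C (n + 1))" for x
    using f that by (simp add: kernel_def coboundary_def fun_eq_iff) meson
  then show "f [^]\<^bsub>?D n\<^esub> N \<in> coboundary C d (n - 1) ` carrier (?D (n - 1))"
    using assms[of f m] fD \<open>m > 0\<close> pow by (simp only: cobd_iff) simp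
qed

end

text \<open>
  Up to the chain homotopy \<open>h\<close>, multiplication by \<open>N\<close> is the map that sends \<open>x\<close> to \<open>e x\<close> times
  the cycle \<open>\<sigma>\<close> and so factors through the integers.
\<close>

locale collapsing_complex = chain_complex +
  fixes N :: nat and h :: "int \<Rightarrow> 'a \<Rightarrow> 'a" and e :: "int \<Rightarrow> 'a \<Rightarrow> int" and \<sigma> :: "int \<Rightarrow> 'a"
  assumes h_hom: "h n \<in> hom (C n) (C (n + 1))"
    and e_hom: "e n \<in> hom (C n) integer_group"
    and \<sigma>_closed: "\<sigma> n \<in> carrier (C n)"
    and d_\<sigma>: "d n (\<sigma> n) = \<one>\<^bsub>C (n - 1)\<^esub>"
    and e_d: "x \<in> carrier (C (n + 1)) \<Longrightarrow> e n (d (n + 1) x) = 0"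
    and homotopy: "x \<in> carrier (C n) \<Longrightarrow>
      x [^]\<^bsub>C n\<^esub> N = \<sigma> n [^]\<^bsub>C n\<^esub> e n x \<otimes>\<^bsub>C n\<^esub> d (n + 1) (h n x) \<otimes>\<^bsub>C n\<^esub> h (n - 1) (d n x)"
begin

lemma h_pred_hom: "h (n - 1) \<in> hom (C (n - 1)) (C n)"
  using h_hom[of "n - 1"] by simp

lemma d_succ_hom: "d (n + 1) \<in> hom (C (n + 1)) (C n)"
  using d_hom[of "n + 1"] by simp

text \<open>
  If a multiple \<open>m x\<close> of a cycle is a boundary, then \<open>m (e x) = 0\<close> and hence \<open>e x = 0\<close>; the homotopy
  then exhibits \<open>N x\<close> as the boundary of \<open>h x\<close>.
\<close>

lemma torsion_homology: "torsion_annihilated_by N (complex_homology C d n)"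
proof (rule torsion_homologyI)
  interpret group "C n" by (rule group_C)
  fix x and m :: nat
  assume x: "x \<in> carrier (C n)" "d n x = \<one>\<^bsub>C (n - 1)\<^esub>" and m: "m > 0"
    and xm: "x [^]\<^bsub>C n\<^esub> m \<in> d (n + 1) ` carrier (C (n + 1))"
  have "int m * e n x = e n (x [^]\<^bsub>C n\<^esub> m)"
    using hom_nat_pow[OF e_hom x(1), of m] by (simp add: group_C)
  then have "e n x = 0"
    using xm m e_d by auto
  moreover have "h (n - 1) (d n x) = \<one>\<^bsub>C n\<^esub>"
    using x hom_one[OF h_pred_hom group_C group_C] by simp
  moreover have "d (n + 1) (h n x) \<in> carrier (C n)"
    by (rule hom_in_carrier[OF d_succ_hom hom_in_carrier[OF h_hom x(1)]])
  ultimately have "x [^]\<^bsub>C n\<^esub> N = d (n + 1) (h n x)"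
    using homotopy[OF x(1)] by simp
  then show "x [^]\<^bsub>C n\<^esub> N \<in> d (n + 1) ` carrier (C (n + 1))"
    using hom_in_carrier[OF h_hom x(1)] by blast
qed

text \<open>
  Dually, if \<open>m f\<close> is the coboundary of \<open>g\<close>, then \<open>m (f \<sigma>) = g (d \<sigma>) = 0\<close>, and the homotopy exhibits
  \<open>N f\<close> as the coboundary of \<open>f \<circ> h\<close>.
\<close>

lemma torsion_cohomology: "torsion_annihilated_by N (complex_cohomology C d n)"
proof (rule torsion_cohomologyI)
  interpret group "C n" by (rule group_C)
  fix f and m :: nat
  assume f: "f \<in> hom (C n) integer_group"
    and cocycle: "\<And>x. x \<in> carrier (C (n + 1)) \<Longrightarrow> f (d (n + 1) x) = 0" and m: "m > 0"
    and "\<exists>g \<in> hom (C (n - 1)) integer_group. \<forall>x \<in> carrier (C n). int m * f x = g (d n x)"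
  then obtain g where g: "g \<in> hom (C (n - 1)) integer_group"
    and fg: "\<And>x. x \<in> carrier (C n) \<Longrightarrow> int m * f x = g (d n x)"
    by auto
  have f\<sigma>: "f (\<sigma> n) = 0"
    using fg[OF \<sigma>_closed] m hom_one[OF g group_C] by (simp add: d_\<sigma>)
  interpret f: group_hom "C n" integer_group f
    using f by (intro group_hom.intro group_hom_axioms.intro group_C) simp_all
  have "int N * f x = f (h (n - 1) (d n x))" if x: "x \<in> carrier (C n)" for x
  proof -
    have hx: "h n x \<in> carrier (C (n + 1))"
      by (rule hom_in_carrier[OF h_hom x])
    have "d (n + 1) (h n x) \<in> carrier (C n)" "h (n - 1) (d n x) \<in> carrier (C n)"
      using hx x by (auto intro: hom_in_carrier[OF d_succ_hom] hom_in_carrier[OF h_pred_hom] d_closed)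
    then show ?thesis
      using f.hom_nat_pow[OF x, of N]
      by (simp add: homotopy[OF x] \<sigma>_closed f\<sigma> cocycle[OF hx] f.hom_int_pow)
  qed
  moreover have "f \<circ> h (n - 1) \<in> hom (C (n - 1)) integer_group"
    by (rule Group.hom_compose[OF h_pred_hom f])
  ultimately show "\<exists>g \<in> hom (C (n - 1)) integer_group. \<forall>x \<in> carrier (C n). int N * f x = g (d n x)"
    by (intro bexI[of _ "f \<circ> h (n - 1)"]) auto
qed

text \<open>
  Applying \<open>\<pi>\<close> to the homotopy relation of \<open>\<iota> x\<close> gives the relation of \<open>x\<close>, since both maps commute
  with the boundaries.
\<close>

lemma retract:
  fixes C' :: "int \<Rightarrow> 'b monoid"
  assumes "chain_complex C' d'"
    and \<pi>: "\<And>n. \<pi> n \<in> hom (C n) (C' n)" and \<iota>: "\<And>n. \<iota> n \<in> hom (C' n) (C n)"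
    and \<pi>_d: "\<And>n x. x \<in> carrier (C n) \<Longrightarrow> \<pi> (n - 1) (d n x) = d' n (\<pi> n x)"
    and \<iota>_d: "\<And>n x. x \<in> carrier (C' n) \<Longrightarrow> \<iota> (n - 1) (d' n x) = d n (\<iota> n x)"
    and \<pi>_\<iota>: "\<And>n x. x \<in> carrier (C' n) \<Longrightarrow> \<pi> n (\<iota> n x) = x"
  shows "collapsing_complex C' d' N (\<lambda>n. \<pi> (n + 1) \<circ> h n \<circ> \<iota> n) (\<lambda>n. e n \<circ> \<iota> n) (\<lambda>n. \<pi> n (\<sigma> n))"
proof -
  interpret C': chain_complex C' d' by fact
  show ?thesis
  proof unfold_locales
    fix n x
    show "\<pi> (n + 1) \<circ> h n \<circ> \<iota> n \<in> hom (C' n) (C' (n + 1))" "e n \<circ> \<iota> n \<in> hom (C' n) integer_group"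
      by (intro hom_compose[OF \<iota>] hom_compose[OF h_hom] \<pi> e_hom)+
    show "\<pi> n (\<sigma> n) \<in> carrier (C' n)"
      by (rule hom_in_carrier[OF \<pi> \<sigma>_closed])
    show "d' n (\<pi> n (\<sigma> n)) = \<one>\<^bsub>C' (n - 1)\<^esub>"
      using \<pi>_d[OF \<sigma>_closed, of n] hom_one[OF \<pi> group_C C'.group_C] by (simp add: d_\<sigma>)
    show "(e n \<circ> \<iota> n) (d' (n + 1) x) = 0" if x: "x \<in> carrier (C' (n + 1))"
      using \<iota>_d[OF x] e_d[OF hom_in_carrier[OF \<iota> x]] by simp
    assume x: "x \<in> carrier (C' n)"
    interpret \<pi>: group_hom "C n" "C' n" "\<pi> n"
      by (intro group_hom.intro group_hom_axioms.intro group_C C'.group_C \<pi>)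
    have ix: "\<iota> n x \<in> carrier (C n)"
      by (rule hom_in_carrier[OF \<iota> x])
    have hx: "h n (\<iota> n x) \<in> carrier (C (n + 1))"
      by (rule hom_in_carrier[OF h_hom ix])
    have "d (n + 1) (h n (\<iota> n x)) \<in> carrier (C n)" "h (n - 1) (d n (\<iota> n x)) \<in> carrier (C n)"
      using hx ix by (auto intro: hom_in_carrier[OF d_succ_hom] hom_in_carrier[OF h_pred_hom] d_closed)
    moreover have "x [^]\<^bsub>C' n\<^esub> N = \<pi> n (\<iota> n x [^]\<^bsub>C n\<^esub> N)"
      by (simp add: \<pi>.hom_nat_pow ix \<pi>_\<iota> x)
    ultimately show "x [^]\<^bsub>C' n\<^esub> N = \<pi> n (\<sigma> n) [^]\<^bsub>C' n\<^esub> (e n \<circ> \<iota> n) x \<otimes>\<^bsub>C' n\<^esub>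
        d' (n + 1) ((\<pi> (n + 1) \<circ> h n \<circ> \<iota> n) x) \<otimes>\<^bsub>C' n\<^esub>
        (\<pi> (n - 1 + 1) \<circ> h (n - 1) \<circ> \<iota> (n - 1)) (d' n x)"
      using \<pi>_d[OF hx] \<iota>_d[OF x]
      by (simp add: homotopy ix \<sigma>_closed \<pi>.hom_int_pow)
  qed
qed

end

section \<open>The rack complex, one entry at a time\<close>

lemmas frag_linear = frag_extend_add frag_extend_diff frag_extend_minus frag_extend_cmul

lemma frag_cmul_right_diff: "frag_cmul k (a - b) = frag_cmul k a - frag_cmul k b"
  by (simp add: poly_mapping_eqI lookup_minus right_diff_distrib)

definition snoc :: "'a \<Rightarrow> ('a list \<Rightarrow>\<^sub>0 int) \<Rightarrow> ('a list \<Rightarrow>\<^sub>0 int)" where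
  "snoc y = frag_extend (\<lambda>xs. frag_of (xs @ [y]))"

lemma snoc_frag_of [simp]: "snoc y (frag_of xs) = frag_of (xs @ [y])"
  by (simp add: snoc_def)

lemma snoc_linear [simp]:
  "snoc y 0 = 0" "snoc y (a + b) = snoc y a + snoc y b" "snoc y (a - b) = snoc y a - snoc y b"
  "snoc y (- a) = - snoc y a" "snoc y (frag_cmul k a) = frag_cmul k (snoc y a)"
  by (simp_all add: snoc_def frag_linear)

lemma snoc_sum: "finite I \<Longrightarrow> snoc y (sum f I) = (\<Sum>i\<in>I. snoc y (f i))"
  by (induction I rule: finite_induct) simp_all

lemma frag_extend_snoc: "frag_extend f (snoc y c) = frag_extend (\<lambda>xs. f (xs @ [y])) c"
  using frag_extend_compose[of f "\<lambda>xs. xs @ [y]" c] by (simp add: snoc_def comp_def)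

lemma keys_snoc: "Poly_Mapping.keys c \<subseteq> rack_tuples X n \<Longrightarrow> y \<in> X \<Longrightarrow> Poly_Mapping.keys (snoc y c) \<subseteq> rack_tuples X (n + 1)"
  unfolding snoc_def using keys_frag_extend[of "\<lambda>xs. frag_of (xs @ [y])" c]
  by (fastforce simp: rack_tuples_def)

text \<open>
  Chains of all degrees at once, so that operators which change the degree can be composed
  without indices.
\<close>

definition list_chains :: "'a set \<Rightarrow> ('a list \<Rightarrow>\<^sub>0 int) set" where
  "list_chains X = {c. Poly_Mapping.keys c \<subseteq> lists X}"

lemma list_chains_simps [simp]:
  "0 \<in> list_chains X" "frag_of xs \<in> list_chains X \<longleftrightarrow> xs \<in> lists X"
  by (simp_all add: list_chains_def)

lemma list_chains_diff: "a \<in> list_chains X \<Longrightarrow> b \<in> list_chains X \<Longrightarrow> a - b \<in> list_chains X"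
  using keys_diff[of a b] by (auto simp: list_chains_def)

lemma list_chains_frag_extend:
  assumes "c \<in> list_chains X" and "\<And>xs. xs \<in> lists X \<Longrightarrow> f xs \<in> list_chains X"
  shows "frag_extend f c \<in> list_chains X"
  using assms keys_frag_extend[of f c] by (fastforce simp: list_chains_def)

lemma list_chains_snoc: "c \<in> list_chains X \<Longrightarrow> y \<in> X \<Longrightarrow> snoc y c \<in> list_chains X"
  unfolding snoc_def by (erule list_chains_frag_extend) simp

text \<open>
  Every tuple arises from the empty one by appending entries. Hence a linear identity holds for
  all chains once it survives the operators \<open>snoc y\<close>. Entries are appended at the end because
  there they act on the whole chain before them, so that \<open>snoc\<close> commutes with the other operators
  up to simple correction terms.
\<close>

lemma list_chains_induct [consumes 1, case_names zero Nil snoc diff]: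
  assumes "c \<in> list_chains X"
    and "P 0" and "P (frag_of [])"
    and snoc: "\<And>c y. c \<in> list_chains X \<Longrightarrow> y \<in> X \<Longrightarrow> P c \<Longrightarrow> P (snoc y c)"
    and diff: "\<And>a b. a \<in> list_chains X \<Longrightarrow> b \<in> list_chains X \<Longrightarrow> P a \<Longrightarrow> P b \<Longrightarrow> P (a - b)"
  shows "P c"
proof -
  have "P (frag_of xs)" if "xs \<in> lists X" for xs
    using that
  proof (induction xs rule: rev_induct)
    case (snoc y xs)
    then show ?case
      using assms(4)[of "frag_of xs" y] by simp
  qed (use assms in simp)
  note basis = this
  have "Poly_Mapping.keys c \<subseteq> lists X"
    using assms(1) by (simp add: list_chains_def)
  then have "c \<in> list_chains X \<and> P c"
  proof (induction c rule: frag_induction)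
    case (diff a b)
    then show ?case
      using assms(5) list_chains_diff by blast
  qed (use assms(2) basis in simp_all)
  then show ?thesis ..
qed

context rack
begin

definition act :: "'a \<Rightarrow> ('a list \<Rightarrow>\<^sub>0 int) \<Rightarrow> ('a list \<Rightarrow>\<^sub>0 int)" where
  "act y = frag_extend (\<lambda>xs. frag_of (map (\<lambda>x. op x y) xs))"

lemma act_frag_of [simp]: "act y (frag_of xs) = frag_of (map (\<lambda>x. op x y) xs)"
  by (simp add: act_def)

lemma act_linear [simp]:
  "act y 0 = 0" "act y (a + b) = act y a + act y b" "act y (a - b) = act y a - act y b"
  "act y (- a) = - act y a"
  by (simp_all add: act_def frag_linear)

lemma act_sum: "finite I \<Longrightarrow> act y (sum f I) = (\<Sum>i\<in>I. act y (f i))"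
  by (induction I rule: finite_induct) simp_all

lemma frag_extend_act: "frag_extend f (act y c) = frag_extend (\<lambda>xs. f (map (\<lambda>x. op x y) xs)) c"
  using frag_extend_compose[of f "map (\<lambda>x. op x y)" c] by (simp add: act_def comp_def)

lemma act_snoc: "act z (snoc y c) = snoc (op y z) (act z c)"
  using subset_UNIV by (induction c rule: frag_induction) simp_all

lemma act_act:
  assumes "c \<in> list_chains X" "y \<in> X" "z \<in> X"
  shows "act z (act y c) = act (op y z) (act z c)"
  using assms(1) by (induction c rule: list_chains_induct) (simp_all add: act_snoc right_distrib assms)

text \<open>
  In degree \<open>n\<close> this is \<open>(-1) ^ n\<close> times the boundary, that is, the signs are counted from the last
  entry. No sign in the recursion \<open>bdry_snoc\<close> then depends on the degree.
\<close>

definition bdry :: "('a list \<Rightarrow>\<^sub>0 int) \<Rightarrow> ('a list \<Rightarrow>\<^sub>0 int)" where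
  "bdry = frag_extend (\<lambda>xs. frag_cmul ((-1) ^ length xs) (rack_boundary op (int (length xs)) (frag_of xs)))"

lemma bdry_linear [simp]:
  "bdry 0 = 0" "bdry (a + b) = bdry a + bdry b" "bdry (a - b) = bdry a - bdry b" "bdry (- a) = - bdry a"
  by (simp_all add: bdry_def frag_linear)

lemma bdry_sum: "finite I \<Longrightarrow> bdry (sum f I) = (\<Sum>i\<in>I. bdry (f i))"
  by (induction I rule: finite_induct) simp_all

lemma bdry_Nil [simp]: "bdry (frag_of []) = 0"
  by (simp add: bdry_def rack_boundary_def)

lemma rack_boundary_eq_bdry:
  assumes "Poly_Mapping.keys c \<subseteq> rack_tuples X n"
  shows "rack_boundary op n c = frag_cmul ((-1) ^ nat n) (bdry c)"
  using assms
proof (induction c rule: frag_induction)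
  case (one xs)
  then have "int (length xs) = n"
    by (simp add: rack_tuples_def)
  then show ?case
    by (auto simp: bdry_def simp flip: power_add)
next
  case (diff a b)
  then show ?case
    by (simp add: rack_boundary_def frag_extend_diff frag_cmul_right_diff)
qed (simp add: rack_boundary_def)

text \<open>
  The last two faces delete \<open>y\<close>, the second after letting it act on the other entries; all other
  faces leave \<open>y\<close> alone and change their sign, because their distance to the end has grown by one.
\<close>

lemma bdry_snoc: "bdry (snoc y c) = c - act y c - snoc y (bdry c)"
proof -
  have "bdry (frag_of (xs @ [y])) = frag_of xs - act y (frag_of xs) - snoc y (bdry (frag_of xs))" for xs
  proof -
    let ?n = "length xs"
    let ?f = "\<lambda>xs i. frag_cmul ((-1) ^ i) (frag_of (rack_face0 i xs) - frag_of (rack_face1 op i xs))"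
    have "?f (xs @ [y]) i = snoc y (?f xs i)" if "i \<in> {1..?n}" for i
      using that by (auto simp: rack_face0_def rack_face1_def nth_append)
    then have "(\<Sum>i = 1..?n. ?f (xs @ [y]) i) = snoc y (\<Sum>i = 1..?n. ?f xs i)"
      unfolding snoc_sum[OF finite_atLeastAtMost] by (rule sum.cong[OF refl])
    then show ?thesis
      by (simp add: bdry_def rack_boundary_def rack_face0_def[of "Suc ?n"] rack_face1_def[of _ "Suc ?n"]
          frag_cmul_right_diff frag_cmul_distrib2 flip: power_add)
  qed
  note basis = this
  show ?thesis
    using subset_UNIV by (induction c rule: frag_induction) (simp_all add: basis)
qed

lemma bdry_act:
  assumes "z \<in> X" "c \<in> list_chains X"
  shows "bdry (act z c) = act z (bdry c)"
  using assms(2)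
proof (induction c rule: list_chains_induct)
  case (snoc c y)
  then show ?case
    by (simp add: bdry_snoc act_snoc act_act[OF _ _ assms(1)])
qed simp_all

lemma bdry_bdry: "c \<in> list_chains X \<Longrightarrow> bdry (bdry c) = 0"
proof (induction c rule: list_chains_induct)
  case (snoc c y)
  then show ?case
    by (simp add: bdry_snoc bdry_act)
qed simp_all

text \<open>
  The two faces with the same index have the same length and opposite signs, so anything that
  depends only on the length vanishes on boundaries.
\<close>

lemma frag_extend_length_bdry: "c \<in> list_chains X \<Longrightarrow> frag_extend (\<lambda>xs. g (length xs)) (bdry c) = 0"
proof (induction c arbitrary: g rule: list_chains_induct)
  case (snoc c y)
  then show ?case
    using snoc.IH[of "\<lambda>n. g (Suc n)"] by (simp add: bdry_snoc frag_extend_diff frag_extend_act frag_extend_snoc)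
qed (simp_all add: frag_extend_diff)

end

lemma sum_frag_constant: "finite I \<Longrightarrow> (\<Sum>i\<in>I. c) = frag_cmul (int (card I)) c"
  by (induction I rule: finite_induct) (simp_all add: frag_cmul_distrib)

lemma hom_frag_extend:
  assumes "\<And>x. x \<in> S \<Longrightarrow> Poly_Mapping.keys (f x) \<subseteq> T"
  shows "frag_extend f \<in> hom (free_Abelian_group S) (free_Abelian_group T)"
proof (rule homI)
  fix c assume "c \<in> carrier (free_Abelian_group S)"
  then show "frag_extend f c \<in> carrier (free_Abelian_group T)"
    by (auto dest!: subsetD[OF keys_frag_extend] subsetD[OF assms, rotated])
qed (simp add: frag_extend_add)

lemma rack_chain_group_simps [simp]:
  "c \<in> carrier (rack_chain_group X n) \<longleftrightarrow> Poly_Mapping.keys c \<subseteq> rack_tuples X n"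
  "a \<otimes>\<^bsub>rack_chain_group X n\<^esub> b = a + b" "\<one>\<^bsub>rack_chain_group X n\<^esub> = 0"
  "group (rack_chain_group X n)" "comm_group (rack_chain_group X n)"
  by (simp_all add: rack_chain_group_def abelian_free_Abelian_group)

lemma rack_tuples_list_chains: "Poly_Mapping.keys c \<subseteq> rack_tuples X n \<Longrightarrow> c \<in> list_chains X"
  by (auto simp: list_chains_def rack_tuples_def)

lemma (in rack) rack_face_tuples:
  assumes "xs \<in> rack_tuples X n" "i \<in> {1..nat n}"
  shows "rack_face0 i xs \<in> rack_tuples X (n - 1)" "rack_face1 op i xs \<in> rack_tuples X (n - 1)"
proof -
  have X: "set xs \<subseteq> X" and len: "int (length xs) = n" and i: "i - 1 < length xs" "1 \<le> i"
    using assms by (simp_all add: rack_tuples_def) linarith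
  have set: "set (take (i - 1) xs) \<subseteq> X" "set (drop i xs) \<subseteq> X" "xs ! (i - 1) \<in> X"
    using order_trans[OF set_take_subset X] order_trans[OF set_drop_subset X] subsetD[OF X nth_mem[OF i(1)]]
    by simp_all
  have "int (length (take (i - 1) xs) + length (drop i xs)) = n - 1"
    using len i by simp
  then show "rack_face0 i xs \<in> rack_tuples X (n - 1)" "rack_face1 op i xs \<in> rack_tuples X (n - 1)"
    using set closed[OF subsetD[OF set(1)] set(3)]
    by (simp_all add: rack_tuples_def rack_face0_def rack_face1_def image_subset_iff)
qed

lemma (in rack) rack_boundary_hom:
  "rack_boundary op n \<in> hom (rack_chain_group X n) (rack_chain_group X (n - 1))"
  unfolding rack_boundary_def rack_chain_group_def
proof (rule hom_frag_extend, rule order_trans[OF keys_sum], rule UN_least)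
  fix xs i assume "xs \<in> rack_tuples X n" "i \<in> {1..nat n}"
  note face = rack_face_tuples[OF this]
  have "Poly_Mapping.keys (frag_of (rack_face0 i xs) - frag_of (rack_face1 op i xs))
      \<subseteq> rack_tuples X (n - 1)"
    using face by (intro order_trans[OF keys_diff]) simp
  then show "Poly_Mapping.keys (frag_cmul ((-1) ^ i) (frag_of (rack_face0 i xs) - frag_of (rack_face1 op i xs)))
      \<subseteq> rack_tuples X (n - 1)"
    by (rule order_trans[OF keys_cmul])
qed

lemma (in rack) keys_rack_boundary:
  "Poly_Mapping.keys c \<subseteq> rack_tuples X n \<Longrightarrow>
    Poly_Mapping.keys (rack_boundary op n c) \<subseteq> rack_tuples X (n - 1)"
  using hom_in_carrier[OF rack_boundary_hom] by simp

lemma (in rack) rack_chain_complex: "chain_complex (rack_chain_group X) (rack_boundary op)"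
proof (rule chain_complex.intro)
  fix n c
  show "rack_boundary op n \<in> hom (rack_chain_group X n) (rack_chain_group X (n - 1))"
    by (rule rack_boundary_hom)
  assume "c \<in> carrier (rack_chain_group X (n + 1))"
  then have c: "Poly_Mapping.keys c \<subseteq> rack_tuples X (n + 1)"
    by simp
  show "rack_boundary op n (rack_boundary op (n + 1) c) = \<one>\<^bsub>rack_chain_group X (n - 1)\<^esub>"
    using keys_rack_boundary[OF c] bdry_bdry[OF rack_tuples_list_chains[OF c]]
    by (simp add: rack_boundary_eq_bdry[of _ n] rack_boundary_eq_bdry[OF c] bdry_def frag_extend_cmul)
qed simp

section \<open>The collapsing homotopy of a finite quasigroup quandle\<close>

text \<open>
  The sum of the coefficients, obtained by mapping the whole basis to a single point.
\<close>

definition augmentation :: "('a \<Rightarrow>\<^sub>0 int) \<Rightarrow> int" where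
  "augmentation c = Poly_Mapping.lookup (frag_extend (\<lambda>_. frag_of ()) c) ()"

lemma augmentation_simps [simp]:
  "augmentation 0 = 0" "augmentation (a + b) = augmentation a + augmentation b"
  "augmentation (a - b) = augmentation a - augmentation b" "augmentation (frag_cmul k a) = k * augmentation a"
  "augmentation (frag_of x) = 1"
  by (simp_all add: augmentation_def frag_linear lookup_add lookup_minus)

text \<open>
  Right translations are bijective in every rack; with bijective left translations the operation
  becomes a quasigroup.
\<close>

locale finite_quasigroup_quandle = quandle +
  assumes finite_X: "finite X"
    and left_bij: "a \<in> X \<Longrightarrow> bij_betw (\<lambda>b. op a b) X X"
begin

definition diag :: "nat \<Rightarrow> 'a list \<Rightarrow>\<^sub>0 int" where
  "diag n = (\<Sum>z\<in>X. frag_of (replicate n z))"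

definition factorisations :: "'a \<Rightarrow> ('a \<times> 'a) set" where
  "factorisations y = {(z, w). z \<in> X \<and> w \<in> X \<and> op z w = y}"

text \<open>
  The two sums join \<open>\<Sum>z. (z, ..., z, z)\<close> and \<open>\<Sum>z. (z, ..., z, y)\<close> by way of \<open>card X\<close> copies of
  \<open>(y, ..., y)\<close>, see \<open>bdry_diag_link\<close>. The pairs \<open>(z, w)\<close> are a choice of \<open>w\<close> with \<open>z * w = y\<close> for
  each \<open>z\<close>.
\<close>

definition diag_link :: "nat \<Rightarrow> 'a \<Rightarrow> 'a list \<Rightarrow>\<^sub>0 int" where
  "diag_link n y = (\<Sum>z\<in>X. frag_of (replicate (Suc n) y @ [z])) -
     (\<Sum>(z, w)\<in>factorisations y. frag_of (replicate n z @ [w, y]))"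

lemma finite_factorisations: "finite (factorisations y)"
  by (rule finite_subset[of _ "X \<times> X"]) (auto simp: factorisations_def finite_X)

lemma bij_fst_factorisations:
  assumes "y \<in> X"
  shows "bij_betw fst (factorisations y) X"
proof (rule bij_betwI')
  fix u v assume "u \<in> factorisations y" "v \<in> factorisations y"
  then show "(fst u = fst v) = (u = v)"
    using left_bij by (auto simp: factorisations_def bij_betw_def inj_on_def)
next
  fix z assume "z \<in> X"
  then obtain w where "w \<in> X" "y = op z w"
    using left_bij[of z] assms by (auto simp: bij_betw_def)
  then show "\<exists>u\<in>factorisations y. z = fst u"
    using \<open>z \<in> X\<close> by (intro bexI[of _ "(z, w)"]) (simp_all add: factorisations_def)
qed (auto simp: factorisations_def)

text \<open>
  Right translations are automorphisms of the rack.
\<close>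

lemma bij_act_factorisations:
  assumes "y \<in> X" "x \<in> X"
  shows "bij_betw (\<lambda>(z, w). (op z x, op w x)) (factorisations y) (factorisations (op y x))"
proof -
  have inj: "op a x = op b x \<longleftrightarrow> a = b" if "a \<in> X" "b \<in> X" for a b
    using right_bij[OF \<open>x \<in> X\<close>] that by (auto simp: bij_betw_def inj_on_def)
  have surj: "\<exists>b\<in>X. a = op b x" if "a \<in> X" for a
    using right_bij[OF \<open>x \<in> X\<close>] that by (auto simp: bij_betw_def)
  show ?thesis
  proof (rule bij_betwI')
    fix u assume "u \<in> factorisations (op y x)"
    then obtain z' w' where u: "u = (z', w')" "z' \<in> X" "w' \<in> X" "op z' w' = op y x"
      by (auto simp: factorisations_def)
    then obtain z w where zw: "z \<in> X" "w \<in> X" "z' = op z x" "w' = op w x"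
      using surj[OF u(2)] surj[OF u(3)] by blast
    then have "op (op z w) x = op y x"
      using u \<open>x \<in> X\<close> by (simp add: right_distrib)
    then have "op z w = y"
      using inj[OF closed[OF zw(1,2)] assms(1)] by simp
    then have "(z, w) \<in> factorisations y"
      using zw by (simp add: factorisations_def)
    then show "\<exists>v\<in>factorisations y. u = (case v of (z, w) \<Rightarrow> (op z x, op w x))"
      using u zw by (intro bexI[of _ "(z, w)"]) simp_all
  next
    fix u assume "u \<in> factorisations y"
    then obtain z w where "u = (z, w)" "z \<in> X" "w \<in> X" "op z w = y"
      by (auto simp: factorisations_def)
    then show "(case u of (z, w) \<Rightarrow> (op z x, op w x)) \<in> factorisations (op y x)"
      using right_distrib[of z w x] \<open>x \<in> X\<close> by (simp add: factorisations_def closed)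
  next
    fix u v assume "u \<in> factorisations y" "v \<in> factorisations y"
    then have "fst u \<in> X" "snd u \<in> X" "fst v \<in> X" "snd v \<in> X"
      by (auto simp: factorisations_def)
    then show "((case u of (z, w) \<Rightarrow> (op z x, op w x)) = (case v of (z, w) \<Rightarrow> (op z x, op w x))) = (u = v)"
      by (simp add: case_prod_unfold inj prod_eq_iff)
  qed
qed

lemma sum_act: "x \<in> X \<Longrightarrow> (\<Sum>z\<in>X. f (op z x)) = (\<Sum>z\<in>X. f z)"
  by (rule sum.reindex_bij_betw[OF right_bij])

lemma sum_factorisations_act:
  assumes "y \<in> X" "x \<in> X"
  shows "(\<Sum>(z, w)\<in>factorisations y. f (op z x) (op w x)) = (\<Sum>(z, w)\<in>factorisations (op y x). f z w)"
  using sum.reindex_bij_betw[OF bij_act_factorisations[OF assms], of "\<lambda>(z, w). f z w"]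
  by (simp add: case_prod_unfold)

text \<open>
  By idempotency the two faces with the same index coincide on a constant tuple.
\<close>

lemma bdry_replicate: "z \<in> X \<Longrightarrow> bdry (frag_of (replicate n z)) = 0"
proof (induction n)
  case (Suc n)
  have "bdry (frag_of (replicate n z @ [z])) = 0"
    using Suc by (simp add: bdry_snoc map_replicate idem flip: snoc_frag_of)
  then show ?case
    by (simp add: replicate_append_same)
qed simp

lemma bdry_diag: "bdry (diag n) = 0"
  by (simp add: diag_def bdry_sum finite_X bdry_replicate)

text \<open>
  If \<open>z * w = y\<close>, then deleting \<open>w\<close> from \<open>(z, ..., z, w, y)\<close>, without and with its action, leaves
  \<open>(z, ..., z, y)\<close> and \<open>(y, ..., y, y)\<close>. The faces that delete \<open>y\<close> cancel in the sum over all \<open>(z, w)\<close>,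
  because the action of \<open>y\<close> permutes the factorisations of \<open>y * y = y\<close>.
\<close>

lemma bdry_diag_link:
  assumes y: "y \<in> X"
  shows "bdry (diag_link n y) = snoc y (diag n) - diag (Suc n)"
proof -
  let ?r = "frag_of (replicate (Suc n) y)"
  have "bdry (\<Sum>z\<in>X. frag_of (replicate (Suc n) y @ [z])) =
      (\<Sum>z\<in>X. ?r - frag_of (replicate (Suc n) (op y z)))"
    by (simp only: bdry_sum[OF finite_X] bdry_snoc bdry_replicate[OF y] act_frag_of map_replicate
        snoc_linear diff_zero flip: snoc_frag_of)
  also have "\<dots> = frag_cmul (int (card X)) ?r - diag (Suc n)"
    using sum.reindex_bij_betw[OF left_bij[OF y], of "\<lambda>z. frag_of (replicate (Suc n) z)"]
    by (simp add: sum_subtractf sum_frag_constant finite_X diag_def)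
  finally have fst: "bdry (\<Sum>z\<in>X. frag_of (replicate (Suc n) y @ [z])) =
      frag_cmul (int (card X)) ?r - diag (Suc n)" .
  have "bdry (frag_of (replicate n z @ [w, y])) =
      frag_of (replicate n z @ [w]) - frag_of (replicate n (op z y) @ [op w y]) -
      snoc y (frag_of (replicate n z)) + ?r" if "(z, w) \<in> factorisations y" for z w
  proof -
    have zw: "z \<in> X" "op z w = y"
      using that by (auto simp: factorisations_def)
    have "frag_of (replicate n z @ [w, y]) = snoc y (snoc w (frag_of (replicate n z)))"
      by simp
    also have "bdry \<dots> = frag_of (replicate n z @ [w]) - frag_of (replicate n (op z y) @ [op w y]) -
        snoc y (frag_of (replicate n z)) + frag_of (replicate n y @ [y])"
      unfolding bdry_snoc by (simp add: bdry_replicate zw map_replicate)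
    finally show ?thesis
      by (simp add: replicate_append_same)
  qed
  then have "bdry (\<Sum>(z, w)\<in>factorisations y. frag_of (replicate n z @ [w, y])) =
      (\<Sum>(z, w)\<in>factorisations y. frag_of (replicate n z @ [w]) -
        frag_of (replicate n (op z y) @ [op w y]) - snoc y (frag_of (replicate n z)) + ?r)"
    by (auto simp: bdry_sum finite_factorisations intro!: sum.cong)
  also have "\<dots> = (\<Sum>(z, w)\<in>factorisations y. frag_of (replicate n z @ [w])) -
      (\<Sum>(z, w)\<in>factorisations y. frag_of (replicate n (op z y) @ [op w y])) -
      (\<Sum>u\<in>factorisations y. snoc y (frag_of (replicate n (fst u)))) + (\<Sum>u\<in>factorisations y. ?r)"
    by (simp add: case_prod_unfold sum.distrib sum_subtractf)
  also have "\<dots> = frag_cmul (int (card X)) ?r - snoc y (diag n)"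
    using sum_factorisations_act[OF y y, of "\<lambda>z w. frag_of (replicate n z @ [w])"]
      sum.reindex_bij_betw[OF bij_fst_factorisations[OF y], of "\<lambda>z. snoc y (frag_of (replicate n z))"]
      bij_betw_same_card[OF bij_fst_factorisations[OF y]]
    by (simp add: idem y sum_frag_constant finite_factorisations diag_def snoc_sum[OF finite_X])
  finally show ?thesis
    unfolding diag_link_def bdry_linear fst by simp
qed

lemma act_diag_link: "y \<in> X \<Longrightarrow> x \<in> X \<Longrightarrow> act x (diag_link n y) = diag_link n (op y x)"
  using sum_act[of x "\<lambda>z. frag_of (replicate (Suc n) (op y x) @ [z])"]
    sum_factorisations_act[of y x "\<lambda>z w. frag_of (replicate n z @ [w, op y x])"]
  by (simp add: diag_link_def act_sum finite_X finite_factorisations map_replicate case_prod_unfold)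

definition diag_map :: "('a list \<Rightarrow>\<^sub>0 int) \<Rightarrow> ('a list \<Rightarrow>\<^sub>0 int)" where
  "diag_map = frag_extend (\<lambda>xs. diag (length xs))"

definition diag_links :: "'a \<Rightarrow> ('a list \<Rightarrow>\<^sub>0 int) \<Rightarrow> ('a list \<Rightarrow>\<^sub>0 int)" where
  "diag_links y = frag_extend (\<lambda>xs. diag_link (length xs) y)"

text \<open>
  The recursion proceeds on reversed tuples, whose head is the entry appended last. The sign makes up
  for the sign of \<open>snoc y (bdry c)\<close> in \<open>bdry_snoc\<close>.
\<close>

primrec rev_collapse :: "'a list \<Rightarrow> 'a list \<Rightarrow>\<^sub>0 int" where
  "rev_collapse [] = 0"
| "rev_collapse (y # ys) = diag_link (length ys) y - snoc y (rev_collapse ys)"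

definition collapse :: "('a list \<Rightarrow>\<^sub>0 int) \<Rightarrow> ('a list \<Rightarrow>\<^sub>0 int)" where
  "collapse = frag_extend (\<lambda>xs. rev_collapse (rev xs))"

lemma collapse_linear [simp]:
  "collapse 0 = 0" "collapse (a + b) = collapse a + collapse b" "collapse (a - b) = collapse a - collapse b"
  by (simp_all add: collapse_def frag_linear)

lemma diag_links_linear [simp]: "diag_links y 0 = 0" "diag_links y (a - b) = diag_links y a - diag_links y b"
  by (simp_all add: diag_links_def frag_linear)

lemma diag_map_linear [simp]: "diag_map 0 = 0" "diag_map (a - b) = diag_map a - diag_map b"
  by (simp_all add: diag_map_def frag_linear)

lemma collapse_Nil [simp]: "collapse (frag_of []) = 0"
  by (simp add: collapse_def)

lemma collapse_snoc: "collapse (snoc y c) = diag_links y c - snoc y (collapse c)"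
  using subset_UNIV by (induction c rule: frag_induction) (simp_all add: collapse_def diag_links_def frag_linear)

lemma diag_links_act: "diag_links y (act x c) = diag_links y c"
  by (simp add: diag_links_def frag_extend_act)

lemma diag_links_bdry: "c \<in> list_chains X \<Longrightarrow> diag_links y (bdry c) = 0"
  unfolding diag_links_def by (rule frag_extend_length_bdry)

lemma act_diag_links: "y \<in> X \<Longrightarrow> x \<in> X \<Longrightarrow> act x (diag_links y c) = diag_links (op y x) c"
  using subset_UNIV
  by (induction c rule: frag_induction) (simp_all add: diag_links_def act_diag_link frag_extend_diff)

lemma bdry_diag_links: "y \<in> X \<Longrightarrow> bdry (diag_links y c) = snoc y (diag_map c) - diag_map (snoc y c)"
  using subset_UNIV
  by (induction c rule: frag_induction)
    (simp_all add: diag_links_def diag_map_def bdry_diag_link frag_extend_diff)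

lemma act_collapse:
  assumes "x \<in> X" "c \<in> list_chains X"
  shows "collapse (act x c) = act x (collapse c)"
  using assms(2)
  by (induction c rule: list_chains_induct)
    (simp_all add: assms(1) act_snoc collapse_snoc diag_links_act act_diag_links)

text \<open>
  When \<open>y\<close> is appended, the relation for \<open>c\<close> turns into the relation for \<open>snoc y c\<close> except for the
  difference of \<open>snoc y (diag_map c)\<close> and \<open>diag_map (snoc y c)\<close>, which is the boundary of
  \<open>diag_links y c\<close>. The terms in which \<open>y\<close> acts cancel because \<open>collapse\<close> commutes with the action,
  and \<open>diag_links y\<close> vanishes on \<open>bdry c\<close>.
\<close>

lemma collapse_homotopy:
  assumes "c \<in> list_chains X"
  shows "frag_cmul (int (card X)) c = diag_map c + bdry (collapse c) + collapse (bdry c)"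
  using assms
proof (induction c rule: list_chains_induct)
  case Nil
  then show ?case
    by (simp add: diag_map_def diag_def sum_frag_constant finite_X)
next
  case (snoc c y)
  have "bdry (collapse (snoc y c)) + collapse (bdry (snoc y c)) =
      snoc y (diag_map c + bdry (collapse c) + collapse (bdry c)) - diag_map (snoc y c)"
    using snoc.hyps
    by (simp add: bdry_snoc collapse_snoc bdry_diag_links diag_links_bdry act_collapse algebra_simps)
  also have "\<dots> = frag_cmul (int (card X)) (snoc y c) - diag_map (snoc y c)"
    by (simp flip: snoc.IH)
  finally show ?case
    by (simp add: add.assoc)
qed (simp_all add: frag_cmul_right_diff)

lemma augmentation_bdry: "c \<in> list_chains X \<Longrightarrow> augmentation (bdry c) = 0"
  using frag_extend_length_bdry[of c "\<lambda>_. frag_of ()"] by (simp add: augmentation_def)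

lemma diag_map_homogeneous:
  assumes "Poly_Mapping.keys c \<subseteq> rack_tuples X n"
  shows "diag_map c = frag_cmul (augmentation c) (diag (nat n))"
  using assms
proof (induction c rule: frag_induction)
  case (one xs)
  then have "length xs = nat n"
    by (auto simp: rack_tuples_def)
  then show ?case
    by (simp add: diag_map_def)
qed (simp_all add: frag_cmul_diff_distrib)

lemma keys_diag: "n \<ge> 0 \<Longrightarrow> Poly_Mapping.keys (diag (nat n)) \<subseteq> rack_tuples X n"
  unfolding diag_def by (rule order_trans[OF keys_sum]) (auto simp: rack_tuples_def)

lemma keys_diag_link: "y \<in> X \<Longrightarrow> Poly_Mapping.keys (diag_link n y) \<subseteq> rack_tuples X (int n + 2)"
  unfolding diag_link_def
  by (intro order_trans[OF keys_diff] Un_least order_trans[OF keys_sum] UN_least)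
    (auto simp: rack_tuples_def factorisations_def)

lemma keys_rev_collapse:
  "set ys \<subseteq> X \<Longrightarrow> Poly_Mapping.keys (rev_collapse ys) \<subseteq> rack_tuples X (int (length ys) + 1)"
proof (induction ys)
  case (Cons y ys)
  then show ?case
    using keys_diag_link[of y "length ys"] keys_snoc[of "rev_collapse ys" X "int (length ys) + 1" y]
    by (intro order_trans[OF keys_diff[of "diag_link (length ys) y" "snoc y (rev_collapse ys)", folded rev_collapse.simps]] Un_least)
      (simp_all add: algebra_simps)
qed simp

lemma collapse_hom: "collapse \<in> hom (rack_chain_group X n) (rack_chain_group X (n + 1))"
  unfolding collapse_def rack_chain_group_def
proof (rule hom_frag_extend)
  fix xs assume "xs \<in> rack_tuples X n"
  then show "Poly_Mapping.keys (rev_collapse (rev xs)) \<subseteq> rack_tuples X (n + 1)"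
    using keys_rev_collapse[of "rev xs"] by (auto simp: rack_tuples_def)
qed

lemma keys_scaled_collapse:
  "Poly_Mapping.keys c \<subseteq> rack_tuples X n \<Longrightarrow>
    Poly_Mapping.keys (frag_cmul k (collapse c)) \<subseteq> rack_tuples X (n + 1)"
  using hom_in_carrier[OF collapse_hom, of c n] by (intro order_trans[OF keys_cmul]) simp

text \<open>
  The power of \<open>-1\<close> compensates for the sign by which \<open>bdry\<close> differs from the boundary. In negative
  degrees the only cycle is \<open>0\<close>.
\<close>

lemma collapsing_rack_complex:
  "collapsing_complex (rack_chain_group X) (rack_boundary op) (card X)
     (\<lambda>n c. frag_cmul ((-1) ^ nat (n + 1)) (collapse c)) (\<lambda>n. augmentation)
     (\<lambda>n. if n \<ge> 0 then diag (nat n) else 0)"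
proof (rule collapsing_complex.intro[OF rack_chain_complex], rule collapsing_complex_axioms.intro)
  fix n :: int and c
  show "(\<lambda>c. frag_cmul ((-1) ^ nat (n + 1)) (collapse c)) \<in> hom (rack_chain_group X n) (rack_chain_group X (n + 1))"
  proof (rule homI)
    fix c assume "c \<in> carrier (rack_chain_group X n)"
    then show "frag_cmul ((-1) ^ nat (n + 1)) (collapse c) \<in> carrier (rack_chain_group X (n + 1))"
      by (simp add: keys_scaled_collapse)
  qed (simp add: collapse_def frag_extend_add frag_cmul_distrib2)
  show "augmentation \<in> hom (rack_chain_group X n) integer_group"
    by (rule homI) simp_all
  show "(if n \<ge> 0 then diag (nat n) else 0) \<in> carrier (rack_chain_group X n)"
    using keys_diag[of n] by simp
  show "rack_boundary op n (if n \<ge> 0 then diag (nat n) else 0) = \<one>\<^bsub>rack_chain_group X (n - 1)\<^esub>"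
    using rack_boundary_eq_bdry[OF keys_diag] by (simp add: bdry_diag) (simp add: rack_boundary_def)
  show "augmentation (rack_boundary op (n + 1) c) = 0" if "c \<in> carrier (rack_chain_group X (n + 1))"
    using that augmentation_bdry[OF rack_tuples_list_chains] by (simp add: rack_boundary_eq_bdry)
  assume "c \<in> carrier (rack_chain_group X n)"
  then have c: "Poly_Mapping.keys c \<subseteq> rack_tuples X n"
    by simp
  show "c [^]\<^bsub>rack_chain_group X n\<^esub> card X =
      (if n \<ge> 0 then diag (nat n) else 0) [^]\<^bsub>rack_chain_group X n\<^esub> augmentation c
      \<otimes>\<^bsub>rack_chain_group X n\<^esub> rack_boundary op (n + 1) (frag_cmul ((-1) ^ nat (n + 1)) (collapse c))
      \<otimes>\<^bsub>rack_chain_group X n\<^esub> frag_cmul ((-1) ^ nat (n - 1 + 1)) (collapse (rack_boundary op n c))"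
  proof (cases "n \<ge> 0")
    case False
    then have "c = 0"
      using c by (auto simp: rack_tuples_def)
    then show ?thesis
      using False by (simp add: rack_chain_group_def rack_boundary_def)
  next
    case True
    have collapse_cmul: "collapse (frag_cmul k a) = frag_cmul k (collapse a)"
      and bdry_cmul: "bdry (frag_cmul k a) = frag_cmul k (bdry a)" for k a
      by (simp_all add: collapse_def bdry_def frag_extend_cmul)
    have "Poly_Mapping.keys (frag_cmul ((-1) ^ nat (n + 1)) (collapse c)) \<subseteq> rack_tuples X (n + 1)"
      using c by (rule keys_scaled_collapse)
    then show ?thesis
      using collapse_homotopy[OF rack_tuples_list_chains[OF c]] keys_diag[OF True] True
      by (simp add: rack_boundary_eq_bdry c collapse_cmul bdry_cmul diag_map_homogeneous[OF c]
          rack_chain_group_def[of X n] flip: power_add)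
  qed
qed

end

section \<open>Splitting off the degenerate chains\<close>

text \<open>
  With tuples regarded as tensors, the list \<open>[x\<^sub>n, ..., x\<^sub>1]\<close> is sent to the expansion of
  \<open>x\<^sub>1 \<otimes> (x\<^sub>2 - x\<^sub>1) \<otimes> (x\<^sub>3 - x\<^sub>2) \<otimes> ...\<close>, one factor for each entry.
\<close>

fun rev_splitting :: "'a list \<Rightarrow> 'a list \<Rightarrow>\<^sub>0 int" where
  "rev_splitting [] = frag_of []"
| "rev_splitting [y] = frag_of [y]"
| "rev_splitting (y # z # ys) = snoc y (rev_splitting (z # ys)) - snoc z (rev_splitting (z # ys))"

text \<open>
  Appending \<open>y\<close> to the splitting of \<open>xs\<close> gives the splitting of \<open>xs @ [y]\<close> up to this term. It is
  made an operator of its own because it depends on the last entry of each tuple of a chain.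
\<close>

definition repeat_last :: "'a list \<Rightarrow> 'a list \<Rightarrow>\<^sub>0 int" where
  "repeat_last xs = (if xs = [] then 0 else snoc (last xs) (rev_splitting (rev xs)))"

definition splitting :: "('a list \<Rightarrow>\<^sub>0 int) \<Rightarrow> ('a list \<Rightarrow>\<^sub>0 int)" where
  "splitting = frag_extend (\<lambda>xs. rev_splitting (rev xs))"

definition splitting_repeat :: "('a list \<Rightarrow>\<^sub>0 int) \<Rightarrow> ('a list \<Rightarrow>\<^sub>0 int)" where
  "splitting_repeat = frag_extend repeat_last"

lemma splitting_linear [simp]:
  "splitting 0 = 0" "splitting (a + b) = splitting a + splitting b" "splitting (a - b) = splitting a - splitting b" "splitting (- a) = - splitting a"
  by (simp_all add: splitting_def frag_linear)

lemma splitting_repeat_linear [simp]: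
  "splitting_repeat 0 = 0" "splitting_repeat (a - b) = splitting_repeat a - splitting_repeat b"
  by (simp_all add: splitting_repeat_def frag_linear)

lemma splitting_Nil [simp]: "splitting (frag_of []) = frag_of []" "splitting_repeat (frag_of []) = 0"
  by (simp_all add: splitting_def splitting_repeat_def repeat_last_def)

lemma splitting_snoc_frag_of:
  "splitting (frag_of (xs @ [y])) = snoc y (splitting (frag_of xs)) - splitting_repeat (frag_of xs)"
  by (cases xs rule: rev_cases) (simp_all add: splitting_def splitting_repeat_def repeat_last_def)

lemma splitting_snoc: "splitting (snoc y c) = snoc y (splitting c) - splitting_repeat c"
  using subset_UNIV by (induction c rule: frag_induction) (simp_all add: splitting_snoc_frag_of)

lemma splitting_repeat_snoc: "splitting_repeat (snoc y c) = snoc y (splitting (snoc y c))"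
  using subset_UNIV
  by (induction c rule: frag_induction) (simp_all add: splitting_repeat_def splitting_def repeat_last_def frag_linear)

lemma keys_rev_splitting: "xs \<in> rack_tuples X n \<Longrightarrow> Poly_Mapping.keys (rev_splitting (rev xs)) \<subseteq> rack_tuples X n"
proof -
  have "set ys \<subseteq> X \<Longrightarrow> Poly_Mapping.keys (rev_splitting ys) \<subseteq> rack_tuples X (int (length ys))" for ys :: "'a list"
  proof (induction ys rule: rev_splitting.induct)
    case (3 y z ys)
    then show ?case
      using keys_snoc[of "rev_splitting (z # ys)" X "int (length (z # ys))"]
      by (auto intro!: order_trans[OF keys_diff] simp: algebra_simps)
  qed (auto simp: rack_tuples_def)
  from this[of "rev xs"] show "xs \<in> rack_tuples X n \<Longrightarrow> ?thesis"
    by (auto simp: rack_tuples_def)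
qed

lemma keys_splitting: "Poly_Mapping.keys c \<subseteq> rack_tuples X n \<Longrightarrow> Poly_Mapping.keys (splitting c) \<subseteq> rack_tuples X n"
  unfolding splitting_def using keys_frag_extend[of "\<lambda>xs. rev_splitting (rev xs)" c] keys_rev_splitting[of _ X n]
  by blast

context quandle
begin

lemma act_snoc_same: "y \<in> X \<Longrightarrow> act y (snoc y c) = snoc y (act y c)"
  by (simp add: act_snoc idem)

lemma act_splitting:
  assumes "z \<in> X" "c \<in> list_chains X"
  shows "splitting (act z c) = act z (splitting c) \<and> splitting_repeat (act z c) = act z (splitting_repeat c)"
  using assms(2)
  by (induction c rule: list_chains_induct) (simp_all add: act_snoc splitting_snoc splitting_repeat_snoc)

text \<open>
  Each of the two operators occurs in the recursion of the other, so both relations are needed at once.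
  The second has a sign because \<open>splitting_repeat\<close> raises the degree by one.
\<close>

lemma bdry_splitting_and_repeat:
  assumes "c \<in> list_chains X"
  shows "bdry (splitting c) = splitting (bdry c) \<and> bdry (splitting_repeat c) = - splitting_repeat (bdry c)"
  using assms
proof (induction c rule: list_chains_induct)
  case (snoc c y)
  then show ?case
    by (simp add: bdry_snoc splitting_snoc splitting_repeat_snoc act_splitting act_snoc_same)
qed simp_all

lemma bdry_splitting: "c \<in> list_chains X \<Longrightarrow> bdry (splitting c) = splitting (bdry c)"
  by (simp add: bdry_splitting_and_repeat)

end

lemma splitting_repeat_frag_of:
  "splitting_repeat (frag_of xs) = (if xs = [] then 0 else snoc (last xs) (splitting (frag_of xs)))"
  by (simp add: splitting_repeat_def repeat_last_def splitting_def)

text \<open>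
  Equal neighbouring entries make one of the tensor factors zero.
\<close>

lemma splitting_degenerate:
  assumes "Suc i < length xs" "xs ! i = xs ! Suc i"
  shows "splitting (frag_of xs) = 0"
  using assms
proof (induction xs arbitrary: i rule: rev_induct)
  case (snoc y xs)
  show ?case
  proof (cases "Suc i < length xs")
    case True
    then have "splitting (frag_of xs) = 0"
      using snoc.prems by (intro snoc.IH[of i]) (simp_all add: nth_append)
    then show ?thesis
      by (simp add: splitting_snoc_frag_of splitting_repeat_frag_of)
  next
    case False
    then have i: "Suc i = length xs"
      using snoc.prems by simp
    then have "xs \<noteq> []"
      by auto
    then have "last xs = xs ! i"
      using i by (metis diff_Suc_1 last_conv_nth)
    moreover have "xs ! i = y"
      using snoc.prems(2) unfolding nth_append i by (simp flip: i)
    ultimately have "last xs = y"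
      by (rule trans)
    then show ?thesis
      using \<open>xs \<noteq> []\<close> by (simp add: splitting_snoc_frag_of splitting_repeat_frag_of)
  qed
qed simp

lemma subgroup_degenerate: "subgroup (degenerate_chains X n) (rack_chain_group X n)"
  unfolding degenerate_chains_def by (rule group.generate_is_subgroup) auto

lemma degenerate_closed:
  "0 \<in> degenerate_chains X n"
  "a \<in> degenerate_chains X n \<Longrightarrow> b \<in> degenerate_chains X n \<Longrightarrow> a + b \<in> degenerate_chains X n"
  "a \<in> degenerate_chains X n \<Longrightarrow> - a \<in> degenerate_chains X n"
proof -
  note sg = subgroup_degenerate[of X n]
  show "0 \<in> degenerate_chains X n"
    using subgroup.one_closed[OF sg] by simp
  show "a + b \<in> degenerate_chains X n" if "a \<in> degenerate_chains X n" "b \<in> degenerate_chains X n"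
    using subgroup.m_closed[OF sg that] by simp
  show "- a \<in> degenerate_chains X n" if "a \<in> degenerate_chains X n"
    using subgroup.m_inv_closed[OF sg that] subgroup.mem_carrier[OF sg that]
    by (simp add: rack_chain_group_def)
qed

lemma degenerate_diff:
  "a \<in> degenerate_chains X n \<Longrightarrow> b \<in> degenerate_chains X n \<Longrightarrow> a - b \<in> degenerate_chains X n"
  using degenerate_closed(2)[of a X n "- b"] degenerate_closed(3)[of b] by simp

lemma degenerate_frag_of:
  "xs \<in> rack_tuples X n \<Longrightarrow> Suc i < length xs \<Longrightarrow> xs ! i = xs ! Suc i \<Longrightarrow>
    frag_of xs \<in> degenerate_chains X n"
  unfolding degenerate_chains_def by (intro generate.incl) auto

lemma degenerate_chains_induct [consumes 1, case_names zero basis diff]: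
  assumes "c \<in> degenerate_chains X n" and "P 0"
    and "\<And>xs i. \<lbrakk>xs \<in> rack_tuples X n; Suc i < length xs; xs ! i = xs ! Suc i\<rbrakk> \<Longrightarrow> P (frag_of xs)"
    and diff: "\<And>a b. P a \<Longrightarrow> P b \<Longrightarrow> P (a - b)"
  shows "P c"
proof -
  have uminus: "P (- a)" if "P a" for a
    using diff[OF \<open>P 0\<close> that] by simp
  show ?thesis
    using assms(1) unfolding degenerate_chains_def
  proof (induction c rule: generate.induct)
    case (eng a b)
    then show ?case
      using diff[OF _ uminus, of a b] by simp
  next
    case (inv c)
    then obtain xs i where c: "c = frag_of xs" and xs: "xs \<in> rack_tuples X n" "Suc i < length xs" "xs ! i = xs ! Suc i"
      by blast
    then have "inv\<^bsub>rack_chain_group X n\<^esub> c = - c"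
      unfolding rack_chain_group_def by (intro inv_free_Abelian_group) simp
    then show ?case
      using uminus[OF assms(3)[OF xs]] by (simp add: c)
  next
    case (incl c)
    then show ?case
      using assms(3) by blast
  qed (simp add: \<open>P 0\<close>)
qed

lemma degenerate_snoc:
  assumes "c \<in> degenerate_chains X n" "y \<in> X"
  shows "snoc y c \<in> degenerate_chains X (n + 1)"
  using assms(1)
proof (induction c rule: degenerate_chains_induct)
  case (basis xs i)
  have "frag_of (xs @ [y]) \<in> degenerate_chains X (n + 1)"
  proof (rule degenerate_frag_of)
    show "xs @ [y] \<in> rack_tuples X (n + 1)"
      using basis(1) assms(2) by (simp add: rack_tuples_def)
    show "Suc i < length (xs @ [y])" "(xs @ [y]) ! i = (xs @ [y]) ! Suc i"
      using basis(2,3) by (simp_all add: nth_append)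
  qed
  then show ?case
    by simp
next
  case (diff a b)
  then show ?case
    by (simp add: degenerate_diff)
qed (simp add: degenerate_closed(1))

lemma splitting_degenerate_chains: "c \<in> degenerate_chains X n \<Longrightarrow> splitting c = 0"
  by (induction c rule: degenerate_chains_induct) (auto intro: splitting_degenerate)

text \<open>
  Modulo degenerate chains the term \<open>splitting_repeat\<close> vanishes, since it repeats an entry; what
  remains of the recursion for \<open>splitting\<close> is that of the identity.
\<close>

lemma diff_splitting_degenerate:
  assumes "Poly_Mapping.keys c \<subseteq> rack_tuples X n"
  shows "c - splitting c \<in> degenerate_chains X n"
  using assms
proof (induction c rule: frag_induction)
  case (one xs)
  then show ?case
  proof (induction xs arbitrary: n rule: rev_induct)
    case (snoc y xs)
    have y: "y \<in> X" and xs: "xs \<in> rack_tuples X (n - 1)"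
      using snoc.prems by (auto simp: rack_tuples_def)
    have snoc_IH: "snoc z (frag_of xs - splitting (frag_of xs)) \<in> degenerate_chains X n" if "z \<in> X" for z
      using degenerate_snoc[OF snoc.IH[OF xs] that] by simp
    have "splitting_repeat (frag_of xs) \<in> degenerate_chains X n"
    proof (cases "xs = []")
      case False
      then have "Suc (length xs - 1) = length xs" and last: "last xs \<in> X"
        using xs last_in_set[of xs] by (auto simp: rack_tuples_def)
      then have "frag_of (xs @ [last xs]) \<in> degenerate_chains X n"
        using snoc.prems False by (intro degenerate_frag_of[of _ _ _ "length xs - 1"])
          (auto simp: rack_tuples_def nth_append last_conv_nth)
      from degenerate_diff[OF this snoc_IH[OF last]] show ?thesis
        using False by (simp add: splitting_repeat_frag_of)
    qed (simp add: degenerate_closed)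
    from degenerate_closed(2)[OF snoc_IH[OF y] this] show ?case
      by (simp add: splitting_snoc_frag_of algebra_simps)
  qed (simp add: degenerate_closed)
next
  case (diff a b)
  then show ?case
    using degenerate_diff[of "a - splitting a" X n "b - splitting b"] by (simp add: algebra_simps)
qed (simp add: degenerate_closed)

text \<open>
  As \<open>splitting\<close> is a chain map, it follows that the degenerate chains form a subcomplex and that
  cosets can be told apart by applying \<open>splitting\<close>.
\<close>

lemma degenerate_chains_eq:
  "degenerate_chains X n = {c. Poly_Mapping.keys c \<subseteq> rack_tuples X n \<and> splitting c = 0}"
  using diff_splitting_degenerate[of _ X n] subgroup.mem_carrier[OF subgroup_degenerate, of _ X n]
  by (auto simp: splitting_degenerate_chains) (metis diff_zero)

section \<open>The quandle complex as a retract of the rack complex\<close>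

context quandle
begin

abbreviation proj :: "int \<Rightarrow> ('a list \<Rightarrow>\<^sub>0 int) \<Rightarrow> ('a list \<Rightarrow>\<^sub>0 int) set" where
  "proj n c \<equiv> degenerate_chains X n #>\<^bsub>rack_chain_group X n\<^esub> c"

lemma proj_eq: "proj n c = (\<lambda>z. z + c) ` degenerate_chains X n"
  by (auto simp: r_coset_def)

lemma normal_degenerate: "degenerate_chains X n \<lhd> rack_chain_group X n"
  using comm_group.normal_iff_subgroup subgroup_degenerate rack_chain_group_simps(5) by blast

lemma proj_hom: "proj n \<in> hom (rack_chain_group X n) (quandle_chain_group X n)"
  unfolding quandle_chain_group_def by (rule normal.r_coset_hom_Mod[OF normal_degenerate])

lemma proj_eqI:
  assumes "Poly_Mapping.keys a \<subseteq> rack_tuples X n" "Poly_Mapping.keys b \<subseteq> rack_tuples X n"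
    and "splitting a = splitting b"
  shows "proj n a = proj n b"
proof -
  interpret group "rack_chain_group X n"
    by simp
  have "Poly_Mapping.keys (a - b) \<subseteq> rack_tuples X n"
    using assms(1,2) keys_diff[of a b] by blast
  then have "a - b \<in> degenerate_chains X n"
    using assms(3) by (simp add: degenerate_chains_eq)
  then have "a \<in> proj n b"
    unfolding proj_eq by (intro image_eqI[of _ _ "a - b"]) simp_all
  then show ?thesis
    using repr_independence[OF _ _ subgroup_degenerate] assms by simp
qed

lemma carrier_quandle_chain_group:
  "carrier (quandle_chain_group X n) = proj n ` carrier (rack_chain_group X n)"
  by (simp add: quandle_chain_group_def carrier_FactGroup)

text \<open>
  All representatives of a coset have the same splitting, which is the only element of the image.
\<close>

definition quandle_section :: "('a list \<Rightarrow>\<^sub>0 int) set \<Rightarrow> ('a list \<Rightarrow>\<^sub>0 int)" where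
  "quandle_section A = the_elem (splitting ` A)"

lemma quandle_section_proj: "quandle_section (proj n c) = splitting c"
proof -
  have "splitting ` proj n c = {splitting c}"
    using degenerate_closed(1)[of X n] by (auto simp: proj_eq image_image splitting_degenerate_chains)
  then show ?thesis
    by (simp add: quandle_section_def)
qed

lemma proj_splitting:
  assumes "Poly_Mapping.keys c \<subseteq> rack_tuples X n"
  shows "proj n (splitting c) = proj n c"
proof (rule proj_eqI)
  show "splitting (splitting c) = splitting c"
    using splitting_degenerate_chains[OF diff_splitting_degenerate[OF assms]] by simp
qed (use assms keys_splitting[OF assms] in auto)

lemma splitting_rack_boundary:
  assumes "Poly_Mapping.keys c \<subseteq> rack_tuples X n"
  shows "splitting (rack_boundary op n c) = rack_boundary op n (splitting c)"
  using assms keys_splitting[OF assms] bdry_splitting[OF rack_tuples_list_chains[OF assms]]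
  by (simp add: rack_boundary_eq_bdry splitting_def frag_extend_cmul)

lemma quandle_boundary_proj:
  assumes c: "Poly_Mapping.keys c \<subseteq> rack_tuples X n"
  shows "quandle_boundary X op n (proj n c) = proj (n - 1) (rack_boundary op n c)"
proof -
  have "proj (n - 1) (rack_boundary op n (z + c)) = proj (n - 1) (rack_boundary op n c)"
    if "z \<in> degenerate_chains X n" for z
  proof (rule proj_eqI)
    have zc: "Poly_Mapping.keys (z + c) \<subseteq> rack_tuples X n"
      using that c keys_add[of z c] by (auto simp: degenerate_chains_eq)
    then show "Poly_Mapping.keys (rack_boundary op n (z + c)) \<subseteq> rack_tuples X (n - 1)"
      by (rule keys_rack_boundary)
    show "splitting (rack_boundary op n (z + c)) = splitting (rack_boundary op n c)"
      using that by (simp add: splitting_rack_boundary zc c splitting_degenerate_chains)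
  qed (rule keys_rack_boundary[OF c])
  then have "(\<lambda>a. proj (n - 1) (rack_boundary op n a)) ` proj n c = {proj (n - 1) (rack_boundary op n c)}"
    using degenerate_closed(1)[of X n] unfolding proj_eq[of n] image_image by auto
  then show ?thesis
    by (simp add: quandle_boundary_def)
qed

lemma hom_quandle_chain_groupI:
  assumes "(\<lambda>c. f (proj n c)) \<in> hom (rack_chain_group X n) G"
  shows "f \<in> hom (quandle_chain_group X n) G"
proof (rule homI)
  fix A B assume "A \<in> carrier (quandle_chain_group X n)" "B \<in> carrier (quandle_chain_group X n)"
  then obtain a b where ab: "a \<in> carrier (rack_chain_group X n)" "b \<in> carrier (rack_chain_group X n)"
    and "A = proj n a" "B = proj n b"
    unfolding carrier_quandle_chain_group by blast
  then have "A \<otimes>\<^bsub>quandle_chain_group X n\<^esub> B = proj n (a \<otimes>\<^bsub>rack_chain_group X n\<^esub> b)"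
    using hom_mult[OF proj_hom] by metis
  then show "f (A \<otimes>\<^bsub>quandle_chain_group X n\<^esub> B) = f A \<otimes>\<^bsub>G\<^esub> f B"
    using hom_mult[OF assms ab] \<open>A = _\<close> \<open>B = _\<close> by simp
qed (use assms in \<open>auto simp: carrier_quandle_chain_group hom_def\<close>)

lemma comm_group_quandle_chain_group: "comm_group (quandle_chain_group X n)"
  unfolding quandle_chain_group_def
  by (rule comm_group.abelian_FactGroup[OF _ subgroup_degenerate]) simp

lemma quandle_chain_complex: "chain_complex (quandle_chain_group X) (quandle_boundary X op)"
proof (rule chain_complex.intro)
  interpret R: chain_complex "rack_chain_group X" "rack_boundary op"
    by (rule rack_chain_complex)
  fix n A
  show "comm_group (quandle_chain_group X n)"
    by (rule comm_group_quandle_chain_group)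
  let ?f = "proj (n - 1) \<circ> rack_boundary op n"
  have f: "?f \<in> hom (rack_chain_group X n) (quandle_chain_group X (n - 1))"
    by (rule Group.hom_compose[OF R.d_hom proj_hom])
  have eq: "quandle_boundary X op n (proj n c) = ?f c" if "c \<in> carrier (rack_chain_group X n)" for c
    using that by (simp add: quandle_boundary_proj)
  have "(\<lambda>c. quandle_boundary X op n (proj n c)) \<in> hom (rack_chain_group X n) (quandle_chain_group X (n - 1))"
  proof (rule homI)
    fix a b assume a: "a \<in> carrier (rack_chain_group X n)" and b: "b \<in> carrier (rack_chain_group X n)"
    show "quandle_boundary X op n (proj n a) \<in> carrier (quandle_chain_group X (n - 1))"
      unfolding eq[OF a] by (rule hom_in_carrier[OF f a])
    have ab: "a \<otimes>\<^bsub>rack_chain_group X n\<^esub> b \<in> carrier (rack_chain_group X n)"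
      by (rule monoid.m_closed[OF group.is_monoid[OF R.group_C] a b])
    show "quandle_boundary X op n (proj n (a \<otimes>\<^bsub>rack_chain_group X n\<^esub> b)) =
        quandle_boundary X op n (proj n a) \<otimes>\<^bsub>quandle_chain_group X (n - 1)\<^esub> quandle_boundary X op n (proj n b)"
      unfolding eq[OF a] eq[OF b] eq[OF ab] by (rule hom_mult[OF f a b])
  qed
  then show "quandle_boundary X op n \<in> hom (quandle_chain_group X n) (quandle_chain_group X (n - 1))"
    by (rule hom_quandle_chain_groupI)
  assume "A \<in> carrier (quandle_chain_group X (n + 1))"
  then obtain c where c: "c \<in> carrier (rack_chain_group X (n + 1))" and A: "A = proj (n + 1) c"
    unfolding carrier_quandle_chain_group by blast
  then have "quandle_boundary X op n (quandle_boundary X op (n + 1) A) = proj (n - 1) 0"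
    using quandle_boundary_proj[of c "n + 1"] quandle_boundary_proj[of _ n]
      keys_rack_boundary[of c "n + 1"] R.d_d[of c n] by simp
  also have "\<dots> = \<one>\<^bsub>quandle_chain_group X (n - 1)\<^esub>"
    using hom_one[OF proj_hom _ comm_group.axioms(2)[OF comm_group_quandle_chain_group]] by simp
  finally show "quandle_boundary X op n (quandle_boundary X op (n + 1) A) = \<one>\<^bsub>quandle_chain_group X (n - 1)\<^esub>" .
qed

text \<open>
  As \<open>collapse\<close> need not preserve degenerate chains, it is applied to the splitting of a
  coset and the result is projected back.
\<close>

lemma collapsing_quandle_complex:
  assumes "collapsing_complex (rack_chain_group X) (rack_boundary op) N h e \<sigma>"
  shows "collapsing_complex (quandle_chain_group X) (quandle_boundary X op) N
    (\<lambda>n. proj (n + 1) \<circ> h n \<circ> quandle_section) (\<lambda>n. e n \<circ> quandle_section) (\<lambda>n. proj n (\<sigma> n))"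
proof (rule collapsing_complex.retract[OF assms, where \<pi> = proj and \<iota> = "\<lambda>_. quandle_section"])
  show "chain_complex (quandle_chain_group X) (quandle_boundary X op)"
    by (rule quandle_chain_complex)
next
  fix n
  show "proj n \<in> hom (rack_chain_group X n) (quandle_chain_group X n)"
    by (rule proj_hom)
  have "(\<lambda>c. quandle_section (proj n c)) \<in> hom (rack_chain_group X n) (rack_chain_group X n)"
    by (rule homI) (simp_all add: quandle_section_proj keys_splitting)
  then show "quandle_section \<in> hom (quandle_chain_group X n) (rack_chain_group X n)"
    by (rule hom_quandle_chain_groupI)
  show "proj (n - 1) (rack_boundary op n c) = quandle_boundary X op n (proj n c)"
    if "c \<in> carrier (rack_chain_group X n)" for c
    using that by (simp add: quandle_boundary_proj)
  fix A assume "A \<in> carrier (quandle_chain_group X n)"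
  then obtain c where "c \<in> carrier (rack_chain_group X n)" and A: "A = proj n c"
    unfolding carrier_quandle_chain_group by blast
  then have c: "Poly_Mapping.keys c \<subseteq> rack_tuples X n"
    by simp
  show "quandle_section (quandle_boundary X op n A) = rack_boundary op n (quandle_section A)"
    using c by (simp add: A quandle_boundary_proj quandle_section_proj splitting_rack_boundary)
  show "proj n (quandle_section A) = A"
    using c by (simp add: A quandle_section_proj proj_splitting)
qed

end

section \<open>The order of a finite quasigroup quandle annihilates torsion\<close>

context finite_quasigroup_quandle
begin

lemma torsion_annihilated_by_card:
  "torsion_annihilated_by (card X) (rack_homology X op n)"
  "torsion_annihilated_by (card X) (rack_cohomology X op n)"
  "torsion_annihilated_by (card X) (quandle_homology X op n)"
  "torsion_annihilated_by (card X) (quandle_cohomology X op n)"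
  unfolding rack_homology_def rack_cohomology_def quandle_homology_def quandle_cohomology_def
  using collapsing_complex.torsion_homology[OF collapsing_rack_complex]
    collapsing_complex.torsion_cohomology[OF collapsing_rack_complex]
    collapsing_complex.torsion_homology[OF collapsing_quandle_complex[OF collapsing_rack_complex]]
    collapsing_complex.torsion_cohomology[OF collapsing_quandle_complex[OF collapsing_rack_complex]]
  by blast+

end

text \<open>
  The left translation \<open>b \<mapsto> 2 b - a\<close> is injective because \<open>2\<close> is invertible modulo \<open>p\<close>.
\<close>

lemma finite_quasigroup_quandle_dihedral:
  assumes "odd p"
  shows "finite_quasigroup_quandle (dihedral_set p) (dihedral_op p)"
proof -
  have "p > 0"
    using assms by (rule odd_pos)
  interpret quandle "dihedral_set p" "dihedral_op p"
    by (rule quandle_dihedral) fact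
  show ?thesis
  proof unfold_locales
    show fin: "finite (dihedral_set p)"
      by (simp add: dihedral_set_def)
    fix a assume a: "a \<in> dihedral_set p"
    have "inj_on (dihedral_op p a) (dihedral_set p)"
    proof (rule inj_onI)
      fix b c assume bc: "b \<in> dihedral_set p" "c \<in> dihedral_set p"
        and "dihedral_op p a b = dihedral_op p a c"
      then have "int p dvd 2 * (b - c)"
        by (simp add: dihedral_op_def mod_eq_dvd_iff algebra_simps)
      moreover have "coprime (int p) 2"
        using assms by simp
      ultimately have "int p dvd b - c"
        by (metis coprime_dvd_mult_right_iff)
      then show "b = c"
        using bc by (simp add: dihedral_set_def mod_eq_dvd_iff[symmetric])
    qed
    moreover have "dihedral_op p a ` dihedral_set p \<subseteq> dihedral_set p"
      using closed[OF a] by blast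
    ultimately show "bij_betw (\<lambda>b. dihedral_op p a b) (dihedral_set p) (dihedral_set p)"
      using endo_inj_surj[OF fin] by (simp add: bij_betw_def)
  qed
qed

theorem mainTheorem4:
  fixes p :: nat and n :: int
  assumes "prime p" and "odd p"
  shows "torsion_annihilated_by p (rack_homology (dihedral_set p) (dihedral_op p) n) \<and>
         torsion_annihilated_by p (rack_cohomology (dihedral_set p) (dihedral_op p) n) \<and>
         torsion_annihilated_by p (quandle_homology (dihedral_set p) (dihedral_op p) n) \<and>
         torsion_annihilated_by p (quandle_cohomology (dihedral_set p) (dihedral_op p) n)"
proof -
  interpret finite_quasigroup_quandle "dihedral_set p" "dihedral_op p"
    using \<open>odd p\<close> by (rule finite_quasigroup_quandle_dihedral)
  have "card (dihedral_set p) = p"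
    by (simp add: dihedral_set_def)
  then show ?thesis
    using torsion_annihilated_by_card[of n] by simp
qed

end
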